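(* Consider the mean-shift model $y=X\beta^\star+\mu^\star+\varepsilon$ with $X\in\mathbb{R}^{n\times p}$ deterministic with columns of unit Euclidean norm, $|\beta^\star|_0\le k$ and $|\mu^\star|_0\le s$ for positive integers $k,s$, and $\varepsilon\sim\mathcal N(0,\sigma^2I_n)$. Let $\lambda_i=\sigma\sqrt{\log(2n/i)}$ for $i=1,\dots,n$, $\tilde\lambda_j=\sigma\sqrt{\log(2p/j)}$ for $j=1,\dots,p$, let $\rho\ge2(4+\sqrt2)$, and let $$(\hat\beta,\hat\mu)\in\arg\min_{\beta\in\mathbb{R}^p,\mu\in\mathbb{R}^n}\Big\{\|y-X\beta-\mu\|_2^2+2\rho J_{\tilde\lambda}(\beta)+2\rho J_\lambda(\mu)\Big\}.$$ Let $k_1=k\log(2ep/k)/\log2$ and $s_1=s\log(2en/s)/\log2$, and suppose there are constants $\kappa_1>2\kappa_2>0$ such that for all $(\beta,\mu)\in\mathbb{R}^p\times\mathbb{R}^n$ satisfying $$\sum_{j=1}^p\frac{\tilde\lambda_j}{\tilde\lambda_p}|\beta|_{(j)}+\sum_{j=1}^n\frac{\lambda_j}{\lambda_n}|\mu|_{(j)}\le5\big(\sqrt{k_1}\|\beta\|_2+\sqrt{s_1}\|\mu\|_2\big)$$ one has $\|X\beta\|_2^2+\|\mu\|_2^2\ge\kappa_1(\|\beta\|_2^2+\|\mu\|_2^2)$ and $|\langle X\beta,\mu\rangle|\le\kappa_2(\|\beta\|_2^2+\|\mu\|_2^2)$. Let $\kappa=\sqrt{\kappa_1-2\kappa_2}$.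 Then there is a constant $C'>0$ depending only on $\rho$ such that, with probability at least $1-\frac12(s/2n)^s-\frac12(k/2p)^k$, $$\|\hat\beta-\beta^\star\|_2^2+\|\hat\mu-\mu^\star\|_2^2\le\frac{C'}{\kappa^4}\Big(\sum_{j=1}^k\tilde\lambda_j^2+\sum_{j=1}^s\lambda_j^2\Big)\le\frac{C'\sigma^2}{\kappa^4}\Big(k\log\Big(\frac{2ep}{k}\Big)+s\log\Big(\frac{2en}{s}\Big)\Big).$$
   Context: For $u\in\mathbb{R}^m$, $|u|_0$ is the number of nonzero entries of $u$, and $|u|_{(1)}\ge\dots\ge|u|_{(m)}$ are the absolute values of its entries sorted in non-increasing order. For a vector $\lambda\in\mathbb{R}^m$ with non-negative non-increasing entries, the sorted-$\ell_1$ norm is $J_\lambda(x)=\sum_{j=1}^m\lambda_j|x|_{(j)}$. *)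

theory Defs
  imports "HOL-Probability.Probability"
begin

text \<open>Vectors in R^m are represented as functions nat => real, only the entries with
index < m are relevant. Sorted absolute values and sorted-l1 norm are 1-based as in the paper.\<close>

definition l0 :: "nat \<Rightarrow> (nat \<Rightarrow> real) \<Rightarrow> nat" where
  "l0 m u = card {i. i < m \<and> u i \<noteq> 0}"

definition sorted_abs :: "nat \<Rightarrow> (nat \<Rightarrow> real) \<Rightarrow> nat \<Rightarrow> real" where
  "sorted_abs m u j = rev (sort (map (\<lambda>i. \<bar>u i\<bar>) [0..<m])) ! (j - 1)"

definition sorted_l1 :: "nat \<Rightarrow> (nat \<Rightarrow> real) \<Rightarrow> (nat \<Rightarrow> real) \<Rightarrow> real" where
  "sorted_l1 m lam x = (\<Sum>j = 1..m. lam j * sorted_abs m x j)"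

definition l2norm :: "nat \<Rightarrow> (nat \<Rightarrow> real) \<Rightarrow> real" where
  "l2norm m x = sqrt (\<Sum>i<m. (x i)\<^sup>2)"

definition matvec :: "nat \<Rightarrow> (nat \<Rightarrow> nat \<Rightarrow> real) \<Rightarrow> (nat \<Rightarrow> real) \<Rightarrow> nat \<Rightarrow> real" where
  "matvec p X b = (\<lambda>i. \<Sum>j<p. X i j * b j)"

definition inner_n :: "nat \<Rightarrow> (nat \<Rightarrow> real) \<Rightarrow> (nat \<Rightarrow> real) \<Rightarrow> real" where
  "inner_n m x y = (\<Sum>i<m. x i * y i)"

definition slope_weights :: "real \<Rightarrow> nat \<Rightarrow> nat \<Rightarrow> real" where
  "slope_weights \<sigma> m i = \<sigma> * sqrt (ln (2 * real m / real i))"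

definition gauss_noise :: "nat \<Rightarrow> real \<Rightarrow> (nat \<Rightarrow> real) measure" where
  "gauss_noise n \<sigma> = PiM {..<n} (\<lambda>_. density lborel (normal_density 0 \<sigma>))"

definition mshift_obj ::
  "nat \<Rightarrow> nat \<Rightarrow> (nat \<Rightarrow> nat \<Rightarrow> real) \<Rightarrow> (nat \<Rightarrow> real) \<Rightarrow> real \<Rightarrow> (nat \<Rightarrow> real) \<Rightarrow> (nat \<Rightarrow> real)
     \<Rightarrow> (nat \<Rightarrow> real) \<Rightarrow> (nat \<Rightarrow> real) \<Rightarrow> real" where
  "mshift_obj n p X y \<rho> lt l b m =
     (\<Sum>i<n. (y i - matvec p X b i - m i)\<^sup>2) + 2 * \<rho> * sorted_l1 p lt b + 2 * \<rho> * sorted_l1 n l m"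

definition is_mshift_min ::
  "nat \<Rightarrow> nat \<Rightarrow> (nat \<Rightarrow> nat \<Rightarrow> real) \<Rightarrow> (nat \<Rightarrow> real) \<Rightarrow> real \<Rightarrow> (nat \<Rightarrow> real) \<Rightarrow> (nat \<Rightarrow> real)
     \<Rightarrow> (nat \<Rightarrow> real) \<Rightarrow> (nat \<Rightarrow> real) \<Rightarrow> bool" where
  "is_mshift_min n p X y \<rho> lt l bh mh \<longleftrightarrow>
     (\<forall>b m. mshift_obj n p X y \<rho> lt l bh mh \<le> mshift_obj n p X y \<rho> lt l b m)"

end

theory Submission
  imports Defs "HOL-Combinatorics.Permutations"
begin

text \<open>
  Each \<open>x\<^sub>j\<^sup>T \<epsilon>\<close> is \<open>N(0, \<sigma>\<^sup>2)\<close>, so \<open>E exp (3 (x\<^sub>j\<^sup>T \<epsilon>)\<^sup>2 / 8 \<sigma>\<^sup>2) = 2\<close>. By Markov's inequality the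
  set \<open>A\<close> on which the averages of these exponentials over the columns of \<open>X\<close> and of the identity
  are at most 8 has probability at least 1/2, and on \<open>A\<close> the \<open>j\<close>-th largest correlation is at most
  \<open>3 \<lambda>\<^sub>j\<close>. Gaussian concentration, in the form \<open>\<gamma>(F) \<gamma>(A) \<le> exp (- r\<^sup>2 / 4 \<sigma>\<^sup>2)\<close> for sets at distance \<open>r\<close>
  (a consequence of the one-dimensional Prekopa-Leindler inequality by tensorization, following
  Maurey), puts \<open>\<epsilon>\<close> with the required probability within a distance \<open>R\<close> of \<open>A\<close>, where \<open>R\<^sup>2\<close> is of the order of
  \<open>\<sigma>\<^sup>2 min (k log (2p/k)) (s log (2n/s))\<close>. Hence
  \<open>\<langle>\<epsilon>, X b + m\<rangle> \<le> 3 (J b + J m) + R \<parallel>X b + m\<parallel>\<close> for all \<open>b\<close> and \<open>m\<close> simultaneously.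
  Inserting this into the basic inequality of the estimator, the error either lies in the cone, where the
  eigenvalue condition applies, or violates the cone condition, in which case the slack in \<open>\<rho>\<close>
  bounds it directly by a multiple of \<open>R\<close>.
\<close>

section \<open>The Prekopa-Leindler inequality on the real line\<close>

lemma emeasure_lborel_midpoint_preimage:
  fixes C :: "real set" and l :: real
  assumes [measurable]: "C \<in> sets borel"
  shows "emeasure lborel {x. (x + l) / 2 \<in> C} = 2 * emeasure lborel C"
proof -
  have "emeasure lborel C = (\<integral>\<^sup>+x. indicator C x \<partial>lborel)"
    by simp
  also have "\<dots> = ennreal (1/2) * (\<integral>\<^sup>+x. indicator C (l / 2 + 1 / 2 * x) \<partial>lborel)"
    by (subst nn_integral_real_affine[where c = "1/2" and t = "l/2"]) auto
  also have "(\<lambda>x. indicator C (l / 2 + 1 / 2 * x) :: ennreal) = indicator {x. (x + l) / 2 \<in> C}"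
    by (auto simp: indicator_def fun_eq_iff field_simps)
  also have "(\<integral>\<^sup>+x. indicator {x. (x + l) / 2 \<in> C} x \<partial>lborel) = emeasure lborel {x. (x + l) / 2 \<in> C}"
    by (rule nn_integral_indicator) measurable
  finally have "2 * emeasure lborel C = (2 * ennreal (1/2)) * emeasure lborel {x. (x + l) / 2 \<in> C}"
    by (simp add: mult.assoc)
  moreover have "2 * ennreal (1/2) = 1"
    by (metis ennreal_1 ennreal_mult'' ennreal_numeral field_sum_of_halves mult_2 zero_le_divide_1_iff zero_le_numeral)
  ultimately show ?thesis by simp
qed

text \<open>With \<open>a = max K\<close> and \<open>b = min L\<close>, the half-sums of
  \<open>K\<close> with \<open>b\<close> lie in \<open>C\<close> to the left of
  \<open>(a + b) / 2\<close> and those of \<open>L\<close> with \<open>a\<close> to the right of it,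
  so half-size copies of both sets fit side by side into \<open>C\<close>.\<close>

lemma brunn_minkowski_compact_real:
  fixes K L C :: "real set"
  assumes "compact K" "K \<noteq> {}" "compact L" "L \<noteq> {}" and C[measurable]: "C \<in> sets borel"
    and mid: "\<And>x y. x \<in> K \<Longrightarrow> y \<in> L \<Longrightarrow> (x + y) / 2 \<in> C"
  shows "emeasure lborel K + emeasure lborel L \<le> 2 * emeasure lborel C"
proof -
  obtain a where a: "a \<in> K" "\<And>x. x \<in> K \<Longrightarrow> x \<le> a"
    using compact_attains_sup[OF assms(1,2)] by blast
  obtain b where b: "b \<in> L" "\<And>y. y \<in> L \<Longrightarrow> b \<le> y"
    using compact_attains_inf[OF assms(3,4)] by blast
  have [measurable]: "L \<in> sets borel" "K \<in> sets borel"
    using assms(1,3) by (auto intro: borel_compact)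
  let ?m = "(a + b) / 2"
  let ?C1 = "C \<inter> {..?m}" and ?C2 = "C \<inter> {?m<..}"
  have "emeasure lborel K \<le> emeasure lborel {x. (x + b) / 2 \<in> ?C1}"
    by (intro emeasure_mono) (use a b mid in \<open>auto simp: divide_right_mono\<close>)
  also have "\<dots> = 2 * emeasure lborel ?C1"
    by (rule emeasure_lborel_midpoint_preimage) auto
  finally have 1: "emeasure lborel K \<le> 2 * emeasure lborel ?C1" .
  \<comment> \<open>The right part \<open>?C2\<close> omits the point \<open>(a + b) / 2\<close> to
    stay disjoint from \<open>?C1\<close>; only \<open>y = b\<close> has it as midpoint with
    \<open>a\<close>, and a single point is null.\<close>
  have "emeasure lborel L \<le> emeasure lborel (insert b {y. (y + a) / 2 \<in> ?C2})"
  proof (intro emeasure_mono subsetI)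
    fix y assume "y \<in> L"
    then show "y \<in> insert b {y. (y + a) / 2 \<in> ?C2}"
      using b(2)[of y] mid[OF a(1), of y] by (auto simp: add.commute)
  qed measurable
  also have "\<dots> \<le> emeasure lborel {b} + emeasure lborel {y. (y + a) / 2 \<in> ?C2}"
    by (subst insert_is_Un, rule emeasure_subadditive) measurable
  also have "\<dots> = 2 * emeasure lborel ?C2"
    using emeasure_lborel_midpoint_preimage[of ?C2 a] by simp
  finally have 2: "emeasure lborel L \<le> 2 * emeasure lborel ?C2" .
  have "emeasure lborel C = emeasure lborel (?C1 \<union> ?C2)"
    by (rule arg_cong[where f = "emeasure lborel"]) auto
  also have "\<dots> = emeasure lborel ?C1 + emeasure lborel ?C2"
    by (rule plus_emeasure[symmetric]) auto
  finally show ?thesis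
    using add_mono[OF 1 2] by (simp add: distrib_left)
qed

text \<open>The rule \<open>inner_regular\<close> is for finite measures, so Lebesgue measure is
  first restricted to \<open>[-N, N]\<close> and then \<open>N\<close> grows. The compact sets are
  kept nonempty, by adjoining a point of \<open>A\<close>, to match the compact Brunn-Minkowski
  inequality.\<close>

lemma emeasure_lborel_inner_regular:
  fixes A :: "real set"
  assumes A[measurable]: "A \<in> sets borel" and "A \<noteq> {}"
  shows "emeasure lborel A = (SUP K\<in>{K. compact K \<and> K \<noteq> {} \<and> K \<subseteq> A}. emeasure lborel K)" (is "_ = ?S")
proof (rule antisym)
  obtain x0 where x0: "x0 \<in> A" using \<open>A \<noteq> {}\<close> by blast
  define J where "J N = {- real N..real N}" for N
  have [measurable]: "J N \<in> sets borel" for N by (simp add: J_def)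
  have "emeasure lborel A = emeasure lborel (\<Union>N. A \<inter> J N)"
  proof (rule arg_cong[where f = "emeasure lborel"])
    have "\<exists>N. x \<in> J N" for x
      using real_arch_simple[of "\<bar>x\<bar>"] unfolding J_def by (auto simp: abs_le_iff) (metis minus_le_iff)
    then show "A = (\<Union>N. A \<inter> J N)" by auto
  qed
  also have "\<dots> = (SUP N. emeasure lborel (A \<inter> J N))"
    by (rule SUP_emeasure_incseq[symmetric]) (auto simp: J_def incseq_def)
  also have "\<dots> \<le> ?S"
  proof (rule SUP_least)
    fix N
    define M where "M = density lborel (indicator (J N) :: real \<Rightarrow> ennreal)"
    have M: "emeasure M B = emeasure lborel (B \<inter> J N)" if "B \<in> sets borel" for B
      using that unfolding M_def
      by (subst emeasure_density) (auto simp: indicator_inter_arith[symmetric] Int_commute)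
    have "emeasure lborel (A \<inter> J N) = emeasure M A" by (simp add: M)
    also have "\<dots> = (SUP K\<in>{K. K \<subseteq> A \<and> compact K}. emeasure M K)"
    proof (rule inner_regular)
      show "sets M = sets borel" by (simp add: M_def)
      have "emeasure M (space M) = emeasure lborel (J N)" using M[of UNIV] by (simp add: M_def)
      then show "emeasure M (space M) \<noteq> \<infinity>" by (simp add: J_def)
    qed simp
    also have "\<dots> \<le> ?S"
    proof (rule SUP_least, clarify)
      fix K assume K: "K \<subseteq> A" "compact K"
      then have [measurable]: "K \<in> sets borel" by (auto intro: borel_compact)
      have "emeasure M K \<le> emeasure lborel (insert x0 K)"
        unfolding M[OF \<open>K \<in> sets borel\<close>] by (rule emeasure_mono) auto
      also have "\<dots> \<le> ?S"
        using K x0 by (intro SUP_upper) auto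
      finally show "emeasure M K \<le> ?S" .
    qed
    finally show "emeasure lborel (A \<inter> J N) \<le> ?S" .
  qed
  finally show "emeasure lborel A \<le> ?S" .
next
  show "?S \<le> emeasure lborel A"
    by (rule SUP_least) (auto intro!: emeasure_mono)
qed

text \<open>Two suprema over compact subsets reduce this to the compact case. Taking any Borel
  \<open>C\<close> that contains the half-sums sidesteps the measurability of the Minkowski
  sum.\<close>

lemma brunn_minkowski_real:
  fixes A B C :: "real set"
  assumes A[measurable]: "A \<in> sets borel" and "A \<noteq> {}" and B[measurable]: "B \<in> sets borel" and "B \<noteq> {}"
    and C[measurable]: "C \<in> sets borel"
    and mid: "\<And>x y. x \<in> A \<Longrightarrow> y \<in> B \<Longrightarrow> (x + y) / 2 \<in> C"
  shows "emeasure lborel A + emeasure lborel B \<le> 2 * emeasure lborel C"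
proof -
  let ?K = "\<lambda>A :: real set. {K. compact K \<and> K \<noteq> {} \<and> K \<subseteq> A}"
  obtain a b where "a \<in> A" "b \<in> B" using \<open>A \<noteq> {}\<close> \<open>B \<noteq> {}\<close> by blast
  then have "{a} \<in> ?K A" "{b} \<in> ?K B" by auto
  then have ne: "?K A \<noteq> {}" "?K B \<noteq> {}" by blast+
  have "emeasure lborel A + emeasure lborel B
      = (SUP K\<in>?K A. emeasure lborel K + (SUP L\<in>?K B. emeasure lborel L))"
    unfolding emeasure_lborel_inner_regular[OF A \<open>A \<noteq> {}\<close>] emeasure_lborel_inner_regular[OF B \<open>B \<noteq> {}\<close>]
    by (rule ennreal_SUP_add_left[symmetric, OF ne(1)])
  also have "\<dots> \<le> 2 * emeasure lborel C"
  proof (rule SUP_least)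
    fix K assume K: "K \<in> ?K A"
    have "emeasure lborel K + (SUP L\<in>?K B. emeasure lborel L)
        = (SUP L\<in>?K B. emeasure lborel K + emeasure lborel L)"
      by (rule ennreal_SUP_add_right[OF ne(2)])
    also have "\<dots> \<le> 2 * emeasure lborel C"
    proof (rule SUP_least)
      fix L assume L: "L \<in> ?K B"
      from K L show "emeasure lborel K + emeasure lborel L \<le> 2 * emeasure lborel C"
        by (intro brunn_minkowski_compact_real C) (auto intro!: mid)
    qed
    finally show "emeasure lborel K + (SUP L\<in>?K B. emeasure lborel L) \<le> 2 * emeasure lborel C" .
  qed
  finally show ?thesis .
qed

section \<open>Layer-cake formula and the passage from sets to functions\<close>

lemma nn_integral_eq_integral_superlevel:
  fixes f :: "real \<Rightarrow> ennreal"
  assumes [measurable]: "f \<in> borel_measurable borel"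
  shows "(\<integral>\<^sup>+x. f x \<partial>lborel)
    = (\<integral>\<^sup>+t. indicator {0..} t * emeasure lborel {x. ennreal t < f x} \<partial>lborel)"
proof -
  have level: "(\<integral>\<^sup>+t. indicator {t. 0 \<le> t \<and> ennreal t < c} t \<partial>lborel) = c" for c
  proof (cases c rule: ennreal_cases)
    case (real r)
    then have "{t. 0 \<le> t \<and> ennreal t < c} = {0..<r}"
      by (auto simp: ennreal_less_iff)
    then show ?thesis using real by simp
  next
    case top
    then have "{t. 0 \<le> t \<and> ennreal t < c} = {0..}" by auto
    moreover have "of_nat m \<le> emeasure lborel {0 :: real..}" for m
      using emeasure_mono[of "{0..real m}" "{0..}" lborel] by (simp add: ennreal_of_nat_eq_real_of_nat)
    then have "(SUP m. of_nat m) \<le> emeasure lborel {0 :: real..}"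
      by (intro SUP_least)
    ultimately show ?thesis using top by (simp add: ennreal_SUP_of_nat_eq_top top_unique)
  qed
  have "(\<integral>\<^sup>+x. f x \<partial>lborel)
      = (\<integral>\<^sup>+x. (\<integral>\<^sup>+t. indicator {t. 0 \<le> t \<and> ennreal t < f x} t \<partial>lborel) \<partial>lborel)"
    by (simp only: level)
  also have "\<dots> = (\<integral>\<^sup>+x. (\<integral>\<^sup>+t. indicator {0..} t * indicator {x. ennreal t < f x} x \<partial>lborel) \<partial>lborel)"
    by (intro nn_integral_cong) (auto simp: indicator_def)
  also have "\<dots> = (\<integral>\<^sup>+t. (\<integral>\<^sup>+x. indicator {0..} t * indicator {x. ennreal t < f x} x \<partial>lborel) \<partial>lborel)"
  proof (rule lborel_pair.Fubini')
    have "(\<lambda>(t, x). indicator {0..} t * indicator {x. ennreal t < f x} x :: ennreal)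
      = (\<lambda>z. indicator {0..} (fst z) * indicator {z. ennreal (fst z) < f (snd z)} z)"
      by (auto simp: indicator_def fun_eq_iff)
    also have "\<dots> \<in> borel_measurable (lborel \<Otimes>\<^sub>M lborel)"
      by measurable
    finally show "(\<lambda>(t, x). indicator {0..} t * indicator {x. ennreal t < f x} x :: ennreal)
      \<in> borel_measurable (lborel \<Otimes>\<^sub>M lborel)" .
  qed
  also have "\<dots> = (\<integral>\<^sup>+t. indicator {0..} t * emeasure lborel {x. ennreal t < f x} \<partial>lborel)"
    by (intro nn_integral_cong) (simp add: nn_integral_cmult)
  finally show ?thesis .
qed

lemma ennreal_power2_less_mult:
  fixes a b :: ennreal
  assumes "ennreal t < a" "ennreal t < b" "0 \<le> t"
  shows "(ennreal t)\<^sup>2 < a * b"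
proof (cases "a = \<top> \<or> b = \<top>")
  case True
  then have "a * b = \<top>" using assms by (auto simp: ennreal_top_mult ennreal_mult_top)
  then show ?thesis using assms(3) by (simp add: ennreal_power)
next
  case False
  then obtain x y where xy: "a = ennreal x" "0 \<le> x" "b = ennreal y" "0 \<le> y"
    by (metis ennreal_cases)
  then have "t < x" "t < y" using assms by (auto simp: ennreal_less_iff)
  then have "t * t < x * y" using assms by (intro mult_strict_mono') auto
  then show ?thesis using xy assms
    by (simp add: power2_eq_square ennreal_mult[symmetric] ennreal_less_iff)
qed

lemma ennreal_mult_le_power2_mean:
  fixes a b c :: ennreal
  assumes "a + b \<le> 2 * c"
  shows "a * b \<le> c\<^sup>2"
proof (cases "c = \<top>")
  case False
  then have "2 * c < \<top>" by (simp add: ennreal_mult_less_top less_top)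
  then have "a + b < \<top>" using assms by (rule le_less_trans[rotated])
  then obtain x y z where xyz: "a = ennreal x" "0 \<le> x" "b = ennreal y" "0 \<le> y" "c = ennreal z" "0 \<le> z"
    using False by (metis ennreal_add_eq_top ennreal_cases less_irrefl)
  then have "ennreal (x + y) \<le> ennreal (2 * z)"
    using assms by (simp add: ennreal_mult ennreal_plus)
  then have "x + y \<le> 2 * z" using xyz by (subst (asm) ennreal_le_iff) auto
  then have "(x + y)\<^sup>2 \<le> (2 * z)\<^sup>2" using xyz by (intro power_mono) auto
  moreover have "0 \<le> (x - y)\<^sup>2" by simp
  ultimately have "x * y \<le> z\<^sup>2" by (simp add: power2_eq_square algebra_simps)
  then show ?thesis using xyz by (simp add: ennreal_mult[symmetric] ennreal_power ennreal_le_iff)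
qed simp

text \<open>Brunn-Minkowski is applied to the superlevel sets at each height. Equal suprema make
  both sets nonempty for every \<open>t < 1\<close> and both empty for \<open>t \<ge> 1\<close>;
  otherwise one could be empty without the other, and the additive bound could fail.\<close>

lemma prekopa_leindler_normalized:
  fixes u v w :: "real \<Rightarrow> ennreal"
  assumes u[measurable]: "u \<in> borel_measurable borel" and v[measurable]: "v \<in> borel_measurable borel"
    and w[measurable]: "w \<in> borel_measurable borel"
    and mid: "\<And>x y. u x * v y \<le> (w ((x + y) / 2))\<^sup>2"
    and sup: "(SUP x. u x) = 1" "(SUP x. v x) = 1"
  shows "(\<integral>\<^sup>+x. u x \<partial>lborel) + (\<integral>\<^sup>+x. v x \<partial>lborel) \<le> 2 * (\<integral>\<^sup>+x. w x \<partial>lborel)"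
proof -
  let ?e = "\<lambda>f t. indicator {0..} t * emeasure lborel {x. ennreal t < (f x :: ennreal)}"
  have [measurable]: "?e f \<in> borel_measurable lborel" if [measurable]: "f \<in> borel_measurable borel" for f
    by measurable
  have "?e u t + ?e v t \<le> 2 * ?e w t" for t :: real
  proof (cases "0 \<le> t \<and> t < 1")
    case False
    have "\<not> ennreal t < u x" "\<not> ennreal t < v x" if "1 \<le> t" for x
    proof -
      have "u x \<le> 1" "v x \<le> 1" using sup by (metis SUP_upper UNIV_I)+
      moreover have "1 \<le> ennreal t" using that by simp
      ultimately show "\<not> ennreal t < u x" "\<not> ennreal t < v x" by (auto simp: not_less intro: order_trans)
    qed
    then show ?thesis using False by (auto simp: indicator_def)
  next
    case True
    then have "ennreal t < 1" by (simp add: ennreal_less_one_iff)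
    then obtain x0 y0 where "ennreal t < u x0" "ennreal t < v y0"
      using sup by (metis less_SUP_iff)
    have "emeasure lborel {x. ennreal t < u x} + emeasure lborel {x. ennreal t < v x}
        \<le> 2 * emeasure lborel {x. ennreal t < w x}"
    proof (rule brunn_minkowski_real)
      fix x y assume "x \<in> {x. ennreal t < u x}" "y \<in> {x. ennreal t < v x}"
      then have "(ennreal t)\<^sup>2 < u x * v y"
        using True by (intro ennreal_power2_less_mult) auto
      also have "\<dots> \<le> (w ((x + y) / 2))\<^sup>2" by (rule mid)
      finally have "ennreal t < w ((x + y) / 2)"
        by (metis not_le power_mono zero_le)
      then show "(x + y) / 2 \<in> {x. ennreal t < w x}" by simp
    qed (use \<open>ennreal t < u x0\<close> \<open>ennreal t < v y0\<close> in auto)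
    then show ?thesis using True by simp
  qed
  then have "(\<integral>\<^sup>+t. ?e u t + ?e v t \<partial>lborel) \<le> (\<integral>\<^sup>+t. 2 * ?e w t \<partial>lborel)"
    by (rule nn_integral_mono)
  then show ?thesis
    unfolding nn_integral_eq_integral_superlevel[OF u] nn_integral_eq_integral_superlevel[OF v]
      nn_integral_eq_integral_superlevel[OF w]
    by (subst (asm) nn_integral_add, measurable) (subst (asm) nn_integral_cmult, measurable)
qed

text \<open>Dividing \<open>u\<close> and \<open>v\<close> by their suprema reaches the normalized
  case. The arithmetic-geometric mean inequality turns its additive bound into a product bound,
  which is homogeneous, so the scaling cancels.\<close>

lemma prekopa_leindler_bounded:
  fixes u v w :: "real \<Rightarrow> ennreal"
  assumes u[measurable]: "u \<in> borel_measurable borel" and v[measurable]: "v \<in> borel_measurable borel"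
    and w[measurable]: "w \<in> borel_measurable borel"
    and mid: "\<And>x y. u x * v y \<le> (w ((x + y) / 2))\<^sup>2"
    and sup: "(SUP x. u x) < \<top>" "(SUP x. v x) < \<top>"
  shows "(\<integral>\<^sup>+x. u x \<partial>lborel) * (\<integral>\<^sup>+x. v x \<partial>lborel) \<le> (\<integral>\<^sup>+x. w x \<partial>lborel)\<^sup>2"
proof (cases "(SUP x. u x) = 0 \<or> (SUP x. v x) = 0")
  case True
  then have "(\<forall>x. u x = 0) \<or> (\<forall>x. v x = 0)"
    by (metis SUP_upper UNIV_I le_zero_eq)
  then show ?thesis by auto
next
  case False
  obtain a where a: "(SUP x. u x) = ennreal a" "0 < a"
    using sup(1) False by (cases "SUP x. u x" rule: ennreal_cases) (auto simp: less_le)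
  obtain b where b: "(SUP x. v x) = ennreal b" "0 < b"
    using sup(2) False by (cases "SUP x. v x" rule: ennreal_cases) (auto simp: less_le)
  \<comment> \<open>\<open>?c\<close> is the geometric mean of the two scalings, which preserves the
    midpoint hypothesis.\<close>
  let ?a = "ennreal (1 / a)" and ?b = "ennreal (1 / b)" and ?c = "ennreal (1 / sqrt (a * b))"
  have c: "?c\<^sup>2 = ?a * ?b"
    using a b by (simp add: ennreal_power ennreal_mult[symmetric] power_divide)
  have "(\<integral>\<^sup>+x. ?a * u x \<partial>lborel) + (\<integral>\<^sup>+x. ?b * v x \<partial>lborel) \<le> 2 * (\<integral>\<^sup>+x. ?c * w x \<partial>lborel)"
  proof (rule prekopa_leindler_normalized)
    show "?a * u x * (?b * v y) \<le> (?c * w ((x + y) / 2))\<^sup>2" for x y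
      using mult_left_mono[OF mid[of x y], of "?a * ?b"]
      by (simp add: power_mult_distrib c ac_simps)
    show "(SUP x. ?a * u x) = 1" "(SUP x. ?b * v x) = 1"
      using a b by (simp_all add: SUP_mult_left_ennreal[symmetric] ennreal_mult[symmetric])
  qed measurable
  then have "(\<integral>\<^sup>+x. ?a * u x \<partial>lborel) * (\<integral>\<^sup>+x. ?b * v x \<partial>lborel) \<le> (\<integral>\<^sup>+x. ?c * w x \<partial>lborel)\<^sup>2"
    by (rule ennreal_mult_le_power2_mean)
  then have "(?a * ?b) * ((\<integral>\<^sup>+x. u x \<partial>lborel) * (\<integral>\<^sup>+x. v x \<partial>lborel)) \<le> (?a * ?b) * (\<integral>\<^sup>+x. w x \<partial>lborel)\<^sup>2"
    by (subst (asm) (1 2 3) nn_integral_cmult) (simp_all add: power_mult_distrib c ac_simps)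
  then have "ennreal (a * b) * ((?a * ?b) * ((\<integral>\<^sup>+x. u x \<partial>lborel) * (\<integral>\<^sup>+x. v x \<partial>lborel)))
      \<le> ennreal (a * b) * ((?a * ?b) * (\<integral>\<^sup>+x. w x \<partial>lborel)\<^sup>2)"
    by (rule mult_left_mono) simp
  moreover have "ennreal (a * b) * (?a * ?b) = 1"
    using a b by (simp add: ennreal_mult[symmetric])
  ultimately show ?thesis by (simp add: mult.assoc[symmetric])
qed

lemma nn_integral_eq_SUP_truncated:
  fixes u :: "'a \<Rightarrow> ennreal"
  assumes [measurable]: "u \<in> borel_measurable M"
  shows "(\<integral>\<^sup>+x. u x \<partial>M) = (SUP m. \<integral>\<^sup>+x. min (u x) (of_nat m) \<partial>M)"
proof -
  have "(SUP m. min c (of_nat m)) = c" for c :: ennreal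
    by (subst inf_min[symmetric], subst inf_SUP[symmetric]) (simp add: ennreal_SUP_of_nat_eq_top)
  then have "(\<integral>\<^sup>+x. u x \<partial>M) = (\<integral>\<^sup>+x. (SUP m. min (u x) (of_nat m)) \<partial>M)" by simp
  also have "\<dots> = (SUP m. \<integral>\<^sup>+x. min (u x) (of_nat m) \<partial>M)"
    by (rule nn_integral_monotone_convergence_SUP)
      (auto simp: incseq_def le_fun_def min_le_iff_disj)
  finally show ?thesis .
qed

text \<open>Cutting \<open>u\<close> and \<open>v\<close> off at integer heights preserves the
  midpoint hypothesis with the same \<open>w\<close>; monotone convergence removes the
  cut-offs.\<close>

theorem prekopa_leindler_real:
  fixes u v w :: "real \<Rightarrow> ennreal"
  assumes u[measurable]: "u \<in> borel_measurable borel" and v[measurable]: "v \<in> borel_measurable borel"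
    and w[measurable]: "w \<in> borel_measurable borel"
    and mid: "\<And>x y. u x * v y \<le> (w ((x + y) / 2))\<^sup>2"
  shows "(\<integral>\<^sup>+x. u x \<partial>lborel) * (\<integral>\<^sup>+x. v x \<partial>lborel) \<le> (\<integral>\<^sup>+x. w x \<partial>lborel)\<^sup>2"
proof -
  let ?t = "\<lambda>f m x. min (f x) (of_nat m) :: ennreal"
  have bounded: "(SUP x. ?t f m x) < \<top>" for f :: "real \<Rightarrow> ennreal" and m
  proof -
    have "(SUP x. ?t f m x) \<le> of_nat m" by (rule SUP_least) auto
    also have "of_nat m < (\<top> :: ennreal)" by (simp add: less_top[symmetric])
    finally show ?thesis .
  qed
  have "(\<integral>\<^sup>+x. ?t u m x \<partial>lborel) * (\<integral>\<^sup>+x. ?t v l x \<partial>lborel) \<le> (\<integral>\<^sup>+x. w x \<partial>lborel)\<^sup>2" for m l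
  proof (rule prekopa_leindler_bounded)
    fix x y
    have "?t u m x * ?t v l y \<le> u x * v y" by (intro mult_mono) auto
    then show "?t u m x * ?t v l y \<le> (w ((x + y) / 2))\<^sup>2" using mid[of x y] by (rule order_trans)
  qed (simp_all add: bounded)
  then show ?thesis
    using nn_integral_eq_SUP_truncated[of u lborel] nn_integral_eq_SUP_truncated[of v lborel] u v
    by (auto simp: SUP_mult_left_ennreal SUP_mult_right_ennreal intro!: SUP_least)
qed

section \<open>Gaussian concentration\<close>

text \<open>By the parallelogram law \<open>x^2 + y^2 = (x + y)^2 / 2 + (x - y)^2 / 2\<close>, the
  exponential is exactly the factor gained when the density moves to the midpoint.\<close>

lemma normal_density_midpoint:
  assumes "\<sigma> > 0"
  shows "normal_density 0 \<sigma> x * normal_density 0 \<sigma> y * exp ((x - y)\<^sup>2 / (4 * \<sigma>\<^sup>2))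
    = (normal_density 0 \<sigma> ((x + y) / 2))\<^sup>2"
proof -
  have "- x\<^sup>2 / (2 * \<sigma>\<^sup>2) + - y\<^sup>2 / (2 * \<sigma>\<^sup>2) + (x - y)\<^sup>2 / (4 * \<sigma>\<^sup>2)
      = - ((x + y) / 2)\<^sup>2 / (2 * \<sigma>\<^sup>2) + - ((x + y) / 2)\<^sup>2 / (2 * \<sigma>\<^sup>2)"
    using assms by (simp add: field_simps power2_eq_square)
  then have "exp (- x\<^sup>2 / (2 * \<sigma>\<^sup>2)) * exp (- y\<^sup>2 / (2 * \<sigma>\<^sup>2)) * exp ((x - y)\<^sup>2 / (4 * \<sigma>\<^sup>2))
      = exp (- ((x + y) / 2)\<^sup>2 / (2 * \<sigma>\<^sup>2)) * exp (- ((x + y) / 2)\<^sup>2 / (2 * \<sigma>\<^sup>2))"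
    by (simp only: exp_add[symmetric])
  then show ?thesis
    by (simp add: normal_density_def power2_eq_square[of "_ / _ * _"] mult.assoc)
       (simp add: power2_eq_square field_simps)
qed

text \<open>Prekopa-Leindler with \<open>w\<close> equal to the Gaussian density and the other two
  functions weighted by it. This is the one-dimensional form of Maurey's property for the quadratic
  cost.\<close>

lemma gauss_transport_real:
  fixes u v :: "real \<Rightarrow> ennreal"
  assumes "\<sigma> > 0" and u[measurable]: "u \<in> borel_measurable borel" and v[measurable]: "v \<in> borel_measurable borel"
    and uv: "\<And>x y. u x * v y \<le> ennreal (exp ((x - y)\<^sup>2 / (4 * \<sigma>\<^sup>2)))"
  shows "(\<integral>\<^sup>+x. u x \<partial>density lborel (normal_density 0 \<sigma>)) * (\<integral>\<^sup>+x. v x \<partial>density lborel (normal_density 0 \<sigma>)) \<le> 1"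
proof -
  let ?f = "\<lambda>x. ennreal (normal_density 0 \<sigma> x)"
  have "(\<integral>\<^sup>+x. ?f x * u x \<partial>lborel) * (\<integral>\<^sup>+x. ?f x * v x \<partial>lborel) \<le> (\<integral>\<^sup>+x. ?f x \<partial>lborel)\<^sup>2"
  proof (rule prekopa_leindler_real)
    fix x y
    have "?f x * u x * (?f y * v y) = ?f x * ?f y * (u x * v y)" by (simp add: ac_simps)
    also have "\<dots> \<le> ?f x * ?f y * ennreal (exp ((x - y)\<^sup>2 / (4 * \<sigma>\<^sup>2)))"
      by (intro mult_left_mono uv) simp
    also have "\<dots> = (?f ((x + y) / 2))\<^sup>2"
      using normal_density_midpoint[OF \<open>\<sigma> > 0\<close>, of x y]
      by (simp add: ennreal_mult[symmetric] ennreal_power)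
    finally show "?f x * u x * (?f y * v y) \<le> (?f ((x + y) / 2))\<^sup>2" .
  qed measurable
  also have "(\<integral>\<^sup>+x. ?f x \<partial>lborel) = 1"
    using \<open>\<sigma> > 0\<close> by (subst nn_integral_eq_integral) auto
  finally show ?thesis by (simp add: nn_integral_density)
qed

text \<open>General index sets, in place of the \<open>{..<n}\<close> of \<open>gauss_noise\<close>,
  allow an induction that adds one coordinate at a time.\<close>

abbreviation gauss_PiM :: "real \<Rightarrow> 'i set \<Rightarrow> ('i \<Rightarrow> real) measure" where
  "gauss_PiM \<sigma> I \<equiv> PiM I (\<lambda>_. density lborel (normal_density 0 \<sigma>))"

text \<open>Tensorization: integrating out the new coordinate turns the hypothesis on
  \<open>insert i I\<close> into the one on \<open>I\<close>, because the squared distance is a sum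
  over coordinates.\<close>

lemma gauss_transport:
  fixes u v :: "('i \<Rightarrow> real) \<Rightarrow> ennreal"
  assumes "finite I" and "\<sigma> > 0"
    and "u \<in> borel_measurable (gauss_PiM \<sigma> I)"
    and "v \<in> borel_measurable (gauss_PiM \<sigma> I)"
    and "\<And>x y. x \<in> space (gauss_PiM \<sigma> I) \<Longrightarrow> y \<in> space (gauss_PiM \<sigma> I) \<Longrightarrow>
      u x * v y \<le> ennreal (exp ((\<Sum>i\<in>I. (x i - y i)\<^sup>2) / (4 * \<sigma>\<^sup>2)))"
  shows "(\<integral>\<^sup>+x. u x \<partial>gauss_PiM \<sigma> I) * (\<integral>\<^sup>+x. v x \<partial>gauss_PiM \<sigma> I) \<le> 1"
  using assms(1,3-)
proof (induction I arbitrary: u v rule: finite_induct)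
  case empty
  \<comment> \<open>The empty product is a point mass at the everywhere \<open>undefined\<close>
    function, where the hypothesis has exponent 0.\<close>
  show ?case
    using empty(3)[of "\<lambda>_. undefined" "\<lambda>_. undefined"]
    by (simp add: PiM_empty nn_integral_count_space_finite)
next
  case (insert i I)
  let ?N = "density lborel (normal_density 0 \<sigma>)"
  interpret product_sigma_finite "\<lambda>_::'i. ?N"
    using prob_space_normal_density[OF \<open>\<sigma> > 0\<close>, of 0]
    by (auto simp: product_sigma_finite_def intro: prob_space_imp_sigma_finite)
  interpret N: sigma_finite_measure ?N by (rule sigma_finite_measures)
  note [measurable] = insert.prems(1,2)
  let ?U = "\<lambda>f x. \<integral>\<^sup>+t. f (x(i := t)) \<partial>?N"
  have "(\<integral>\<^sup>+x. ?U u x \<partial>gauss_PiM \<sigma> I) * (\<integral>\<^sup>+x. ?U v x \<partial>gauss_PiM \<sigma> I) \<le> 1"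
  proof (rule insert.IH)
    show "?U u \<in> borel_measurable (gauss_PiM \<sigma> I)" "?U v \<in> borel_measurable (gauss_PiM \<sigma> I)"
      by measurable
    fix x y assume [measurable]: "x \<in> space (gauss_PiM \<sigma> I)" "y \<in> space (gauss_PiM \<sigma> I)"
    let ?S = "(\<Sum>i\<in>I. (x i - y i)\<^sup>2) / (4 * \<sigma>\<^sup>2)"
    have [measurable]: "(\<lambda>t. x(i := t)) \<in> borel \<rightarrow>\<^sub>M gauss_PiM \<sigma> (insert i I)" "(\<lambda>t. y(i := t)) \<in> borel \<rightarrow>\<^sub>M gauss_PiM \<sigma> (insert i I)"
      using measurable_component_update[of x I "\<lambda>_. ?N" i] measurable_component_update[of y I "\<lambda>_. ?N" i] insert(2)
      by (simp_all add: measurable_cong_sets[OF sets_density refl] cong: measurable_cong_sets)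
    \<comment> \<open>The factor \<open>exp (- ?S)\<close> cancels the cost of the coordinates in
      \<open>I\<close>, leaving exactly the one-dimensional hypothesis in \<open>s\<close> and
      \<open>t\<close>.\<close>
    have "(\<integral>\<^sup>+t. ennreal (exp (- ?S)) * u (x(i := t)) \<partial>?N) * (\<integral>\<^sup>+t. v (y(i := t)) \<partial>?N) \<le> 1"
    proof (rule gauss_transport_real[OF \<open>\<sigma> > 0\<close>])
      fix s t
      have eq: "(\<Sum>j\<in>insert i I. ((x(i := s)) j - (y(i := t)) j)\<^sup>2) = (s - t)\<^sup>2 + (\<Sum>j\<in>I. (x j - y j)\<^sup>2)"
        using insert(1,2) by (auto intro!: sum.cong)
      have upd: "x(i := s) \<in> space (gauss_PiM \<sigma> (insert i I))" "y(i := t) \<in> space (gauss_PiM \<sigma> (insert i I))" for s t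
        using \<open>x \<in> _\<close> \<open>y \<in> _\<close> by (auto simp: space_PiM PiE_def extensional_def)
      have "u (x(i := s)) * v (y(i := t)) \<le> ennreal (exp (((s - t)\<^sup>2 + (\<Sum>j\<in>I. (x j - y j)\<^sup>2)) / (4 * \<sigma>\<^sup>2)))"
        using insert.prems(3)[OF upd, of s t] unfolding eq .
      then have "ennreal (exp (- ?S)) * (u (x(i := s)) * v (y(i := t)))
          \<le> ennreal (exp (- ?S)) * ennreal (exp (((s - t)\<^sup>2 + (\<Sum>j\<in>I. (x j - y j)\<^sup>2)) / (4 * \<sigma>\<^sup>2)))"
        by (rule mult_left_mono) simp
      then show "ennreal (exp (- ?S)) * u (x(i := s)) * v (y(i := t)) \<le> ennreal (exp ((s - t)\<^sup>2 / (4 * \<sigma>\<^sup>2)))"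
        by (simp add: ennreal_mult[symmetric] exp_add[symmetric] add_divide_distrib mult.assoc)
    qed measurable
    then have "ennreal (exp (- ?S)) * (?U u x * ?U v y) \<le> 1"
      by (subst (asm) nn_integral_cmult) (simp_all add: mult.assoc)
    then have "ennreal (exp ?S) * (ennreal (exp (- ?S)) * (?U u x * ?U v y)) \<le> ennreal (exp ?S) * 1"
      by (rule mult_left_mono) simp
    then show "?U u x * ?U v y \<le> ennreal (exp ?S)"
      by (simp add: mult.assoc[symmetric] ennreal_mult[symmetric] exp_add[symmetric])
  qed
  then show ?case
    using insert by (simp add: product_nn_integral_insert)
qed

section \<open>Euclidean norm and enlargements of a set of probability at least one half\<close>

lemma l2norm_eq_L2_set: "l2norm m x = L2_set x {..<m}"
  by (simp add: l2norm_def L2_set_def)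

lemma l2norm_diff_triangle:
  "l2norm n (\<lambda>i. x i - z i) \<le> l2norm n (\<lambda>i. x i - y i) + l2norm n (\<lambda>i. y i - z i)"
  using L2_set_triangle_ineq[of "\<lambda>i. x i - y i" "\<lambda>i. y i - z i" "{..<n}"]
  by (simp add: l2norm_eq_L2_set)

lemma l2norm_diff_commute: "l2norm n (\<lambda>i. x i - y i) = l2norm n (\<lambda>i. y i - x i)"
  by (simp add: l2norm_def power2_commute)

lemma l2norm_nonneg [simp]: "0 \<le> l2norm n x"
  by (simp add: l2norm_def sum_nonneg)

lemma l2norm_power2: "(l2norm n x)\<^sup>2 = (\<Sum>i<n. (x i)\<^sup>2)"
  by (simp add: l2norm_def sum_nonneg)

text \<open>Rational centres make it possible to write an enlargement as a countable union of balls,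
  hence as a measurable set.\<close>

lemma rational_approx_l2norm:
  fixes a :: "nat \<Rightarrow> real"
  assumes "0 < e"
  obtains q where "q \<in> {..<n} \<rightarrow>\<^sub>E \<rat>" "l2norm n (\<lambda>i. a i - q i) < e"
proof -
  define d where "d = e / (real n + 1)"
  have "d > 0" using assms by (simp add: d_def)
  then have "\<forall>i. \<exists>q\<in>\<rat>. a i - d < q \<and> q < a i"
    using Rats_dense_in_real by simp
  then obtain q where q: "\<And>i. q i \<in> \<rat>" "\<And>i. \<bar>a i - q i\<bar> \<le> d"
    by (auto simp: choice_iff Bex_def) (smt (verit))
  have "l2norm n (\<lambda>i. a i - restrict q {..<n} i) \<le> (\<Sum>i<n. \<bar>a i - restrict q {..<n} i\<bar>)"
    unfolding l2norm_eq_L2_set by (rule L2_set_le_sum_abs)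
  also have "\<dots> \<le> real n * d"
    using sum_bounded_above[of "{..<n}" "\<lambda>i. \<bar>a i - restrict q {..<n} i\<bar>" d] q(2) by simp
  also have "\<dots> < e" using assms by (simp add: d_def field_simps)
  finally show ?thesis using q(1) by (intro that[of "restrict q {..<n}"]) auto
qed

lemma measurable_gauss_noise_component:
  "i < n \<Longrightarrow> (\<lambda>x. x i) \<in> borel_measurable (gauss_noise n \<sigma>)"
  using measurable_component_singleton[of i "{..<n}" "\<lambda>_. density lborel (normal_density 0 \<sigma>)"]
  by (simp add: gauss_noise_def cong: measurable_cong_sets)

lemma prob_space_gauss_noise: "\<sigma> > 0 \<Longrightarrow> prob_space (gauss_noise n \<sigma>)"
  unfolding gauss_noise_def by (intro prob_space_PiM prob_space_normal_density)

text \<open>\<open>E\<close> is an enlargement of \<open>A\<close> whose complement stays at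
  distance at least \<open>r\<close> from \<open>A\<close>. Gaussian transport applied to the two
  indicators bounds the product of their probabilities by
  \<open>exp (- r^2 / (4 * \<sigma>^2))\<close>, and \<open>1 / 2\<close> for \<open>A\<close> costs
  the factor 2.\<close>

theorem gauss_concentration:
  assumes "\<sigma> > 0" "r > 0" and A[measurable]: "A \<in> sets (gauss_noise n \<sigma>)"
    and half: "measure (gauss_noise n \<sigma>) A \<ge> 1 / 2"
  obtains E where "E \<in> sets (gauss_noise n \<sigma>)"
    "measure (gauss_noise n \<sigma>) E \<ge> 1 - 2 * exp (- r\<^sup>2 / (4 * \<sigma>\<^sup>2))"
    "\<And>x. x \<in> E \<Longrightarrow> \<exists>a\<in>A. l2norm n (\<lambda>i. x i - a i) \<le> 2 * r"
proof -
  let ?G = "gauss_noise n \<sigma>" and ?d = "\<lambda>x y. l2norm n (\<lambda>i. x i - y i)"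
  interpret prob_space ?G by (rule prob_space_gauss_noise) fact
  \<comment> \<open>Centres within \<open>r / 2\<close> of \<open>A\<close> and radius
    \<open>3 * r / 2\<close>: points of \<open>E\<close> are within \<open>2 * r\<close> of
    \<open>A\<close>, while the others are at least \<open>3 * r / 2 - r / 2 = r\<close>
    away.\<close>
  define Q where "Q = {q \<in> {..<n} \<rightarrow>\<^sub>E \<rat>. \<exists>a\<in>A. ?d a q < r / 2}"
  have "countable ({..<n} \<rightarrow>\<^sub>E (\<rat> :: real set))"
    by (intro countable_PiE) (auto simp: countable_rat)
  then have Q: "countable Q" by (rule countable_subset[rotated]) (auto simp: Q_def)
  define E where "E = (\<Union>q\<in>Q. {x \<in> space ?G. ?d x q < 3 * r / 2})"
  have ball: "{x \<in> space ?G. ?d x q < 3 * r / 2} \<in> sets ?G" for q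
    unfolding l2norm_def using measurable_gauss_noise_component[measurable] by measurable
  have E[measurable]: "E \<in> sets ?G"
    unfolding E_def using Q ball by (intro sets.countable_UN'')
  have near: "\<exists>a\<in>A. ?d x a \<le> 2 * r" if "x \<in> E" for x
  proof -
    from that obtain q a where "?d x q < 3 * r / 2" "a \<in> A" "?d a q < r / 2"
      by (auto simp: E_def Q_def)
    then show ?thesis
      using l2norm_diff_triangle[of n x a q] l2norm_diff_commute[of n a q] by (intro bexI[of _ a]) auto
  qed
  have far: "r \<le> ?d x a" if "x \<in> space ?G - E" "a \<in> A" for x a
  proof -
    obtain q where q: "q \<in> {..<n} \<rightarrow>\<^sub>E \<rat>" "?d a q < r / 2"
      using rational_approx_l2norm[of "r / 2" n a] \<open>r > 0\<close> by auto
    then have "\<not> ?d x q < 3 * r / 2" using that by (auto simp: E_def Q_def)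
    then show ?thesis using q l2norm_diff_triangle[of n x q a] by linarith
  qed
  let ?c = "r\<^sup>2 / (4 * \<sigma>\<^sup>2)"
  \<comment> \<open>The transport hypothesis has content only where both indicators are 1, and there
    the distance is at least \<open>r\<close>.\<close>
  have "(\<integral>\<^sup>+x. ennreal (exp ?c) * indicator (space ?G - E) x \<partial>?G) * (\<integral>\<^sup>+x. indicator A x \<partial>?G) \<le> 1"
    unfolding gauss_noise_def
  proof (rule gauss_transport; (unfold gauss_noise_def[symmetric])?)
    fix x y assume "x \<in> space ?G" "y \<in> space ?G"
    show "ennreal (exp ?c) * indicator (space ?G - E) x * indicator A y
      \<le> ennreal (exp ((\<Sum>i\<in>{..<n}. (x i - y i)\<^sup>2) / (4 * \<sigma>\<^sup>2)))"
    proof (cases "x \<in> space ?G - E \<and> y \<in> A")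
      case True
      then have "r\<^sup>2 \<le> (?d x y)\<^sup>2" using far \<open>r > 0\<close> by (intro power_mono) auto
      then show ?thesis using True by (auto simp: l2norm_power2 intro!: divide_right_mono ennreal_leI)
    qed (auto simp: indicator_def)
  qed (use \<open>\<sigma> > 0\<close> in measurable)
  then have "ennreal (exp ?c) * emeasure ?G (space ?G - E) * emeasure ?G A \<le> 1"
    by (simp add: nn_integral_cmult)
  then have "exp ?c * prob (space ?G - E) * prob A \<le> 1"
    by (simp add: emeasure_eq_measure ennreal_mult[symmetric])
  moreover have "exp ?c * prob (space ?G - E) * (1 / 2) \<le> exp ?c * prob (space ?G - E) * prob A"
    by (intro mult_left_mono half) simp
  ultimately have "exp ?c * prob (space ?G - E) \<le> 2" by linarith
  then have "prob (space ?G - E) \<le> 2 * exp (- ?c)"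
    by (simp add: exp_minus field_simps)
  then have "prob E \<ge> 1 - 2 * exp (- r\<^sup>2 / (4 * \<sigma>\<^sup>2))"
    by (simp add: prob_compl)
  then show ?thesis using that[OF E] near by blast
qed

section \<open>The sorted l1 norm\<close>

text \<open>The bijection sends an index to its 1-based rank in decreasing order of absolute value;
  through it, sums over sorted values become sums over the original indices.\<close>

lemma sorted_abs_bij:
  obtains \<pi> where "bij_betw \<pi> {..<m} {1..m}" "\<And>i. i < m \<Longrightarrow> sorted_abs m u (\<pi> i) = \<bar>u i\<bar>"
proof -
  define xs where "xs = map (\<lambda>i. \<bar>u i\<bar>) [0..<m]"
  define ys where "ys = rev (sort xs)"
  have "mset ys = mset xs" by (simp add: ys_def)
  then obtain p where p: "p permutes {..<length xs}" "permute_list p xs = ys"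
    by (rule mset_eq_permutation)
  have len: "length xs = m" by (simp add: xs_def)
  let ?q = "inv p"
  have q: "?q permutes {..<m}" using p(1) len by (simp add: permutes_inv)
  have "bij_betw (Suc \<circ> ?q) {..<m} {1..m}"
  proof (rule bij_betw_trans)
    show "bij_betw ?q {..<m} {..<m}" using q by (rule permutes_imp_bij)
    show "bij_betw Suc {..<m} {1..m}"
      by (auto simp: bij_betw_def lessThan_atLeast0)
  qed
  moreover have "sorted_abs m u ((Suc \<circ> ?q) i) = \<bar>u i\<bar>" if "i < m" for i
  proof -
    have "?q i < m" using that q permutes_in_image[OF q, of i] by simp
    then have "ys ! ?q i = xs ! p (?q i)"
      using p len by (metis permute_list_nth)
    also have "\<dots> = \<bar>u i\<bar>" using p(1) that by (simp add: permutes_inverses xs_def)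
    finally show ?thesis by (simp add: sorted_abs_def ys_def xs_def)
  qed
  ultimately show ?thesis by (rule that)
qed

lemma sorted_abs_antimono:
  assumes "1 \<le> i" "i \<le> j" "j \<le> m"
  shows "sorted_abs m u j \<le> sorted_abs m u i"
  unfolding sorted_abs_def using assms by (intro sorted_rev_nth_mono) auto

lemma sorted_abs_nonneg:
  assumes "1 \<le> j" "j \<le> m"
  shows "0 \<le> sorted_abs m u j"
proof -
  obtain \<pi> where \<pi>: "bij_betw \<pi> {..<m} {1..m}" "\<And>i. i < m \<Longrightarrow> sorted_abs m u (\<pi> i) = \<bar>u i\<bar>"
    using sorted_abs_bij[of m u] by blast
  have "j \<in> \<pi> ` {..<m}" using \<pi>(1) assms by (simp add: bij_betw_def)
  then show ?thesis using \<pi>(2) by auto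
qed

lemma sum_sorted_abs: "(\<Sum>j = 1..m. f (sorted_abs m u j)) = (\<Sum>i<m. f \<bar>u i\<bar>)"
proof -
  obtain \<pi> where \<pi>: "bij_betw \<pi> {..<m} {1..m}" "\<And>i. i < m \<Longrightarrow> sorted_abs m u (\<pi> i) = \<bar>u i\<bar>"
    using sorted_abs_bij[of m u] by blast
  show ?thesis
    by (subst sum.reindex_bij_betw[OF \<pi>(1), symmetric]) (simp add: \<pi>(2))
qed

section \<open>Rearrangement inequality and duality for the sorted norm\<close>

lemma sorted_l1_bij:
  assumes "bij_betw \<pi> {..<m} {1..m}"
  shows "sorted_l1 m lam u = (\<Sum>i<m. lam (\<pi> i) * sorted_abs m u (\<pi> i))"
  unfolding sorted_l1_def by (rule sum.reindex_bij_betw[OF assms, symmetric])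

text \<open>Exchange argument: outside their common part both sets have equally many elements, and
  the value at \<open>card B\<close> separates those of \<open>B\<close> from those of the initial
  segment.\<close>

lemma sum_le_sum_initial_segment:
  fixes a :: "nat \<Rightarrow> real"
  assumes anti: "\<And>i j. 1 \<le> i \<Longrightarrow> i \<le> j \<Longrightarrow> j \<le> m \<Longrightarrow> a j \<le> a i"
    and B: "B \<subseteq> {1..m}"
  shows "sum a B \<le> sum a {1..card B}"
proof (cases "B = {}")
  case False
  let ?l = "card B"
  have fin: "finite B" using B finite_subset by blast
  have l: "1 \<le> ?l" "?l \<le> m"
    using fin False card_mono[OF _ B] by (auto simp: Suc_le_eq card_gt_0_iff)
  have c: "card (B - {1..?l}) = card ({1..?l} - B)"
  proof -
    have "card (B - {1..?l}) = card B - card (B \<inter> {1..?l})"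
      using fin by (simp add: card_Diff_subset_Int)
    moreover have "card ({1..?l} - B) = ?l - card (B \<inter> {1..?l})"
      by (simp add: card_Diff_subset_Int Int_commute)
    ultimately show ?thesis by simp
  qed
  have "sum a (B - {1..?l}) \<le> real (card (B - {1..?l})) * a ?l"
  proof (rule sum_bounded_above)
    fix j assume "j \<in> B - {1..?l}"
    then show "a j \<le> a ?l" using B l by (intro anti) auto
  qed
  also have "\<dots> \<le> sum a ({1..?l} - B)"
    unfolding c by (rule sum_bounded_below) (use l in \<open>auto intro!: anti\<close>)
  finally have "sum a (B \<inter> {1..?l}) + sum a (B - {1..?l}) \<le> sum a ({1..?l} \<inter> B) + sum a ({1..?l} - B)"
    by (simp add: Int_commute)
  then show ?thesis
    unfolding sum.Int_Diff[OF fin, of a "{1..?l}", symmetric]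
      sum.Int_Diff[OF finite_atLeastAtMost, of a 1 ?l B, symmetric] .
qed simp

text \<open>Hardy-Littlewood rearrangement by Abel summation: \<open>b\<close> is a nonnegative
  combination of indicators of initial segments, and for one such segment the point is that the
  first \<open>l\<close> values of \<open>a\<close> have the largest sum among any \<open>l\<close>
  of them.\<close>

lemma rearrangement_le:
  fixes a b :: "nat \<Rightarrow> real"
  assumes \<pi>: "bij_betw \<pi> I {1..m}" and \<tau>: "bij_betw \<tau> I {1..m}"
    and a: "\<And>i j. 1 \<le> i \<Longrightarrow> i \<le> j \<Longrightarrow> j \<le> m \<Longrightarrow> a j \<le> a i"
    and b: "\<And>i j. 1 \<le> i \<Longrightarrow> i \<le> j \<Longrightarrow> j \<le> m \<Longrightarrow> b j \<le> b i"
    and b0: "\<And>j. 1 \<le> j \<Longrightarrow> j \<le> m \<Longrightarrow> 0 \<le> b j"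
  shows "(\<Sum>i\<in>I. a (\<pi> i) * b (\<tau> i)) \<le> (\<Sum>j = 1..m. a j * b j)"
proof -
  have fin: "finite I" using \<pi> bij_betw_finite by blast
  \<comment> \<open>Extending \<open>b\<close> by 0 beyond \<open>m\<close> makes the last
    difference \<open>d m\<close> equal to \<open>b m\<close>, so that telescoping leaves no
    remainder.\<close>
  define c where "c j = (if j \<le> m then b j else 0)" for j
  define d where "d l = c l - c (Suc l)" for l
  have d: "0 \<le> d l" if "l \<in> {1..m}" for l
    using that b[of l "Suc l"] b0[of l] by (auto simp: d_def c_def)
  have abel: "b j = (\<Sum>l\<in>{1..m}. if j \<le> l then d l else 0)" if "j \<in> {1..m}" for j
  proof -
    have "(\<Sum>l\<in>{1..m}. if j \<le> l then d l else 0) = (\<Sum>l\<in>{1..m} \<inter> {l. j \<le> l}. d l)"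
      by (simp add: sum.inter_restrict)
    also have "{1..m} \<inter> {l. j \<le> l} = {j..m}" using that by auto
    also have "(\<Sum>l = j..m. d l) = - (\<Sum>l = j..m. c (Suc l) - c l)"
      by (simp add: d_def sum_negf[symmetric])
    also have "\<dots> = c j - c (Suc m)"
      using that by (subst sum_Suc_diff) auto
    finally show ?thesis using that by (simp add: c_def)
  qed
  have swap: "(\<Sum>i\<in>I. a (\<phi> i) * b (\<tau> i)) = (\<Sum>l\<in>{1..m}. d l * (\<Sum>i\<in>{i\<in>I. \<tau> i \<le> l}. a (\<phi> i)))" for \<phi>
  proof -
    have "(\<Sum>i\<in>I. a (\<phi> i) * b (\<tau> i)) = (\<Sum>i\<in>I. \<Sum>l\<in>{1..m}. if \<tau> i \<le> l then d l * a (\<phi> i) else 0)"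
    proof (rule sum.cong)
      fix i assume "i \<in> I"
      then have "\<tau> i \<in> {1..m}" using \<tau> by (auto simp: bij_betw_def)
      then show "a (\<phi> i) * b (\<tau> i) = (\<Sum>l\<in>{1..m}. if \<tau> i \<le> l then d l * a (\<phi> i) else 0)"
        by (subst abel) (auto simp: sum_distrib_left intro!: sum.cong)
    qed simp
    also have "\<dots> = (\<Sum>l\<in>{1..m}. \<Sum>i\<in>I. if \<tau> i \<le> l then d l * a (\<phi> i) else 0)"
      by (rule sum.swap)
    also have "\<dots> = (\<Sum>l\<in>{1..m}. d l * (\<Sum>i\<in>{i\<in>I. \<tau> i \<le> l}. a (\<phi> i)))"
      using fin by (auto simp: sum.inter_filter sum_distrib_left intro!: sum.cong)
    finally show ?thesis .
  qed
  have "(\<Sum>i\<in>{i\<in>I. \<tau> i \<le> l}. a (\<pi> i)) \<le> (\<Sum>i\<in>{i\<in>I. \<tau> i \<le> l}. a (\<tau> i))" if "l \<in> {1..m}" for l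
  proof -
    let ?L = "{i\<in>I. \<tau> i \<le> l}"
    have inj: "inj_on \<pi> ?L" "inj_on \<tau> ?L"
      using \<pi> \<tau> by (auto simp: bij_betw_def intro: inj_on_subset)
    have img: "\<tau> ` ?L = {1..l}"
    proof -
      have "\<tau> ` I = {1..m}" using \<tau> by (simp add: bij_betw_def)
      then show ?thesis using that by (auto simp: set_eq_iff image_iff) (metis atLeastAtMost_iff imageE le_trans)+
    qed
    have card: "card (\<pi> ` ?L) = l"
      using card_image[OF inj(1)] card_image[OF inj(2)] img by simp
    have "(\<Sum>i\<in>?L. a (\<pi> i)) = sum a (\<pi> ` ?L)" using inj(1) by (simp add: sum.reindex)
    also have "\<dots> \<le> sum a {1..card (\<pi> ` ?L)}"
      by (rule sum_le_sum_initial_segment[where m = m, OF a]) (use \<pi> in \<open>auto simp: bij_betw_def\<close>)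
    also have "\<dots> = (\<Sum>i\<in>?L. a (\<tau> i))"
      unfolding card img[symmetric] using inj(2) by (simp add: sum.reindex)
    finally show ?thesis .
  qed
  then have "d l * (\<Sum>i\<in>{i\<in>I. \<tau> i \<le> l}. a (\<pi> i)) \<le> d l * (\<Sum>i\<in>{i\<in>I. \<tau> i \<le> l}. a (\<tau> i))"
    if "l \<in> {1..m}" for l
    using that d by (intro mult_left_mono) auto
  then have "(\<Sum>i\<in>I. a (\<pi> i) * b (\<tau> i)) \<le> (\<Sum>i\<in>I. a (\<tau> i) * b (\<tau> i))"
    unfolding swap by (rule sum_mono)
  also have "\<dots> = (\<Sum>j = 1..m. a j * b j)"
    by (rule sum.reindex_bij_betw[OF \<tau>])
  finally show ?thesis .
qed

lemma sorted_l1_ge_bij: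
  assumes anti: "\<And>i j. 1 \<le> i \<Longrightarrow> i \<le> j \<Longrightarrow> j \<le> m \<Longrightarrow> lam j \<le> lam i"
    and \<pi>: "bij_betw \<pi> {..<m} {1..m}"
  shows "(\<Sum>i<m. lam (\<pi> i) * \<bar>u i\<bar>) \<le> sorted_l1 m lam u"
proof -
  obtain \<tau> where \<tau>: "bij_betw \<tau> {..<m} {1..m}" "\<And>i. i < m \<Longrightarrow> sorted_abs m u (\<tau> i) = \<bar>u i\<bar>"
    using sorted_abs_bij[of m u] by blast
  have "(\<Sum>i<m. lam (\<pi> i) * \<bar>u i\<bar>) = (\<Sum>i<m. lam (\<pi> i) * sorted_abs m u (\<tau> i))"
    by (simp add: \<tau>(2))
  also have "\<dots> \<le> sorted_l1 m lam u"
    unfolding sorted_l1_def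
    by (rule rearrangement_le[OF \<pi> \<tau>(1) anti]) (auto intro: sorted_abs_antimono sorted_abs_nonneg)
  finally show ?thesis .
qed

text \<open>Ranking by \<open>a\<close> bounds \<open>\<bar>a i\<bar>\<close> by \<open>c\<close>
  times the weight of its rank, and any assignment of the weights to the entries of \<open>u\<close>
  gives at most the sorted norm.\<close>

lemma inner_le_sorted_l1:
  assumes anti: "\<And>i j. 1 \<le> i \<Longrightarrow> i \<le> j \<Longrightarrow> j \<le> m \<Longrightarrow> lam j \<le> lam i"
    and a: "\<And>j. 1 \<le> j \<Longrightarrow> j \<le> m \<Longrightarrow> sorted_abs m a j \<le> c * lam j" and "0 \<le> c"
  shows "inner_n m a u \<le> c * sorted_l1 m lam u"
proof -
  obtain \<pi> where \<pi>: "bij_betw \<pi> {..<m} {1..m}" "\<And>i. i < m \<Longrightarrow> sorted_abs m a (\<pi> i) = \<bar>a i\<bar>"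
    using sorted_abs_bij[of m a] by blast
  have "inner_n m a u \<le> (\<Sum>i<m. c * (lam (\<pi> i) * \<bar>u i\<bar>))"
    unfolding inner_n_def
  proof (rule sum_mono)
    fix i assume "i \<in> {..<m}"
    then have "\<pi> i \<in> {1..m}" using \<pi>(1) by (auto simp: bij_betw_def)
    then have "\<bar>a i\<bar> \<le> c * lam (\<pi> i)" using a[of "\<pi> i"] \<pi>(2)[of i] \<open>i \<in> _\<close> by auto
    then have "\<bar>a i\<bar> * \<bar>u i\<bar> \<le> c * lam (\<pi> i) * \<bar>u i\<bar>" by (rule mult_right_mono) simp
    moreover have "a i * u i \<le> \<bar>a i\<bar> * \<bar>u i\<bar>" by (simp add: abs_mult[symmetric])
    ultimately show "a i * u i \<le> c * (lam (\<pi> i) * \<bar>u i\<bar>)" by (simp add: mult.assoc)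
  qed
  also have "\<dots> \<le> c * sorted_l1 m lam u"
    unfolding sum_distrib_left[symmetric]
    by (intro mult_left_mono sorted_l1_ge_bij anti \<pi>(1) \<open>0 \<le> c\<close>)
  finally show ?thesis .
qed

section \<open>Order statistics by counting, and comparison with a sparse vector\<close>

lemma card_bij_less:
  assumes "bij_betw \<pi> {..<m} {1..m}" "i < m"
  shows "card {l. l < m \<and> \<pi> l < \<pi> i} < \<pi> i"
proof -
  have i: "1 \<le> \<pi> i" using assms by (auto simp: bij_betw_def)
  have "\<pi> ` {l. l < m \<and> \<pi> l < \<pi> i} \<subseteq> {1..<\<pi> i}" using assms by (auto simp: bij_betw_def)
  then have "card (\<pi> ` {l. l < m \<and> \<pi> l < \<pi> i}) \<le> \<pi> i - 1"
    using card_mono[of "{1..<\<pi> i}"] by simp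
  moreover have "inj_on \<pi> {l. l < m \<and> \<pi> l < \<pi> i}"
    using assms by (auto simp: bij_betw_def intro: inj_on_subset)
  ultimately show ?thesis using i by (simp add: card_image)
qed

lemma sorted_abs_le:
  assumes "1 \<le> j" "j \<le> m" and card: "card {i. i < m \<and> t < \<bar>u i\<bar>} < j"
  shows "sorted_abs m u j \<le> t"
proof (rule ccontr)
  assume "\<not> sorted_abs m u j \<le> t"
  obtain \<pi> where \<pi>: "bij_betw \<pi> {..<m} {1..m}" "\<And>i. i < m \<Longrightarrow> sorted_abs m u (\<pi> i) = \<bar>u i\<bar>"
    using sorted_abs_bij[of m u] by blast
  have "{1..j} \<subseteq> \<pi> ` {i. i < m \<and> t < \<bar>u i\<bar>}"
  proof
    fix l assume l: "l \<in> {1..j}"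
    then have "l \<in> \<pi> ` {..<m}" using \<pi>(1) assms by (simp add: bij_betw_def)
    then obtain i where i: "i < m" "l = \<pi> i" by auto
    have "t < sorted_abs m u l"
      using \<open>\<not> _\<close> sorted_abs_antimono[of l j m u] l assms by auto
    then show "l \<in> \<pi> ` {i. i < m \<and> t < \<bar>u i\<bar>}" using i \<pi>(2) by auto
  qed
  then have "card {1..j} \<le> card {i. i < m \<and> t < \<bar>u i\<bar>}"
    by (rule surj_card_le[rotated]) simp
  then show False using card by simp
qed

text \<open>Every entry of \<open>u\<close> larger than \<open>\<bar>u i\<bar>\<close> precedes
  \<open>i\<close> in the ranking by \<open>w\<close>, so fewer than \<open>\<pi> i\<close> entries
  exceed \<open>\<bar>u i\<bar>\<close>. Compatibility of the two orders is asked at the single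
  index \<open>i\<close>, which lets one ranking serve two vectors on different index sets.\<close>

lemma sorted_abs_le_of_order:
  assumes \<pi>: "bij_betw \<pi> {..<m} {1..m}" "\<And>i. i < m \<Longrightarrow> sorted_abs m w (\<pi> i) = \<bar>w i\<bar>"
    and i: "i < m" and order: "\<And>l. l < m \<Longrightarrow> \<bar>u i\<bar> < \<bar>u l\<bar> \<Longrightarrow> \<bar>w i\<bar> < \<bar>w l\<bar>"
  shows "sorted_abs m u (\<pi> i) \<le> \<bar>u i\<bar>"
proof -
  have range: "1 \<le> \<pi> l \<and> \<pi> l \<le> m" if "l < m" for l
    using \<pi>(1) that by (auto simp: bij_betw_def)
  have "{l. l < m \<and> \<bar>u i\<bar> < \<bar>u l\<bar>} \<subseteq> {l. l < m \<and> \<pi> l < \<pi> i}"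
  proof clarify
    fix l assume l: "l < m" "\<bar>u i\<bar> < \<bar>u l\<bar>"
    show "\<pi> l < \<pi> i"
    proof (rule ccontr)
      assume "\<not> \<pi> l < \<pi> i"
      then have "\<bar>w l\<bar> \<le> \<bar>w i\<bar>"
        using sorted_abs_antimono[of "\<pi> i" "\<pi> l" m w] range i l \<pi>(2) by auto
      then show False using order[OF l] by simp
    qed
  qed
  then have "card {l. l < m \<and> \<bar>u i\<bar> < \<bar>u l\<bar>} \<le> card {l. l < m \<and> \<pi> l < \<pi> i}"
    by (intro card_mono) auto
  also have "\<dots> < \<pi> i" by (rule card_bij_less[OF \<pi>(1) i])
  finally show ?thesis using range[OF i] by (intro sorted_abs_le) auto
qed

lemma sum_mult_le_l2norm:
  assumes "finite I" and \<pi>: "inj_on \<pi> I" "\<pi> ` I = {1..k}"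
  shows "(\<Sum>i\<in>I. lam (\<pi> i) * \<bar>d i\<bar>) \<le> sqrt (\<Sum>j = 1..k. (lam j)\<^sup>2) * L2_set d I"
proof -
  have "(\<Sum>i\<in>I. lam (\<pi> i) * \<bar>d i\<bar>) \<le> (\<Sum>i\<in>I. \<bar>lam (\<pi> i)\<bar> * \<bar>d i\<bar>)"
    by (intro sum_mono mult_right_mono) auto
  also have "\<dots> \<le> L2_set (\<lambda>i. lam (\<pi> i)) I * L2_set d I"
    by (rule L2_set_mult_ineq)
  also have "L2_set (\<lambda>i. lam (\<pi> i)) I = sqrt (\<Sum>j = 1..k. (lam j)\<^sup>2)"
    unfolding L2_set_def \<pi>(2)[symmetric] by (simp add: sum.reindex[OF \<pi>(1)])
  finally show ?thesis .
qed

text \<open>The bijection that puts the support of \<open>b\<close> first, ordered by \<open>b\<close>, and the rest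
  afterwards, ordered by \<open>h - b\<close>, is optimal for \<open>b\<close> and admissible for \<open>h\<close>.\<close>

lemma sorted_l1_sparse_diff:
  assumes anti: "\<And>i j. 1 \<le> i \<Longrightarrow> i \<le> j \<Longrightarrow> j \<le> m \<Longrightarrow> lam j \<le> lam i"
    and lam0: "\<And>j. 1 \<le> j \<Longrightarrow> j \<le> m \<Longrightarrow> 0 \<le> lam j"
    and sparse: "l0 m b \<le> k" and "k \<le> m"
  shows "sorted_l1 m lam b - sorted_l1 m lam h
    \<le> 2 * (sqrt (\<Sum>j = 1..k. (lam j)\<^sup>2) * l2norm m (\<lambda>i. h i - b i)) - sorted_l1 m lam (\<lambda>i. h i - b i)"
proof -
  define d where "d i = h i - b i" for i
  \<comment> \<open>\<open>M\<close> exceeds every \<open>\<bar>d l\<bar>\<close>, so in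
    \<open>w\<close> the support of \<open>b\<close> outranks all other indices.\<close>
  define M where "M = (\<Sum>l<m. \<bar>d l\<bar>) + 1"
  have M: "\<bar>d l\<bar> < M" if "l < m" for l
    using member_le_sum[of l "{..<m}" "\<lambda>l. \<bar>d l\<bar>"] that by (simp add: M_def)
  define w where "w i = (if b i \<noteq> 0 then \<bar>b i\<bar> + M else \<bar>d i\<bar>)" for i
  have "0 < M" by (simp add: M_def add_nonneg_pos sum_nonneg)
  have w: "\<bar>w i\<bar> = (if b i \<noteq> 0 then \<bar>b i\<bar> + M else \<bar>d i\<bar>)" for i
    using \<open>0 < M\<close> by (auto simp: w_def)
  obtain \<pi> where \<pi>: "bij_betw \<pi> {..<m} {1..m}" "\<And>i. i < m \<Longrightarrow> sorted_abs m w (\<pi> i) = \<bar>w i\<bar>"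
    using sorted_abs_bij[of m w] by blast
  have range: "1 \<le> \<pi> l \<and> \<pi> l \<le> m" if "l < m" for l
    using \<pi>(1) that by (auto simp: bij_betw_def)
  have inj: "inj_on \<pi> {..<m}" using \<pi>(1) by (simp add: bij_betw_def)
  have supp: "\<pi> i \<le> k" if i: "i < m" "b i \<noteq> 0" for i
  proof -
    have "{1..\<pi> i} \<subseteq> \<pi> ` {l. l < m \<and> b l \<noteq> 0}"
    proof
      fix j assume j: "j \<in> {1..\<pi> i}"
      then have "j \<in> \<pi> ` {..<m}" using \<pi>(1) range[OF i(1)] by (simp add: bij_betw_def)
      then obtain l where l: "l < m" "j = \<pi> l" by auto
      then have "\<bar>w i\<bar> \<le> \<bar>w l\<bar>"
        using sorted_abs_antimono[of "\<pi> l" "\<pi> i" m w] range[OF i(1)] j i \<pi>(2) by auto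
      then have "b l \<noteq> 0" using i M[OF l(1)] by (auto simp: w split: if_splits)
      then show "j \<in> \<pi> ` {l. l < m \<and> b l \<noteq> 0}" using l by auto
    qed
    then have "card {1..\<pi> i} \<le> card {l. l < m \<and> b l \<noteq> 0}"
      by (rule surj_card_le[rotated]) simp
    then show ?thesis using sparse by (simp add: l0_def)
  qed
  let ?K = "{i. i < m \<and> \<pi> i \<le> k}" and ?R = "{i. i < m \<and> k < \<pi> i}"
  have split: "sum f {..<m} = sum f ?K + sum f ?R" for f :: "nat \<Rightarrow> real"
    by (subst sum.union_disjoint[symmetric]) (auto intro!: sum.cong)
  have K: "inj_on \<pi> ?K" "\<pi> ` ?K = {1..k}"
  proof -
    show "inj_on \<pi> ?K" using inj by (rule inj_on_subset) auto
    have "\<pi> ` {..<m} = {1..m}" using \<pi>(1) by (simp add: bij_betw_def)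
    then show "\<pi> ` ?K = {1..k}"
      using \<open>k \<le> m\<close> by (auto simp: set_eq_iff image_iff) (metis atLeastAtMost_iff imageE le_trans lessThan_iff)+
  qed
  let ?B = "sqrt (\<Sum>j = 1..k. (lam j)\<^sup>2) * l2norm m d"
  have "sorted_l1 m lam b \<le> (\<Sum>i<m. lam (\<pi> i) * \<bar>b i\<bar>)"
    unfolding sorted_l1_bij[OF \<pi>(1)]
  proof (intro sum_mono mult_left_mono lam0)
    fix i assume i: "i \<in> {..<m}"
    show "sorted_abs m b (\<pi> i) \<le> \<bar>b i\<bar>"
      by (rule sorted_abs_le_of_order[OF \<pi>]) (use i M[of i] in \<open>auto simp: w\<close>)
  qed (use range in auto)
  moreover have "(\<Sum>i<m. lam (\<pi> i) * \<bar>h i\<bar>) \<le> sorted_l1 m lam h"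
    by (rule sorted_l1_ge_bij[OF anti \<pi>(1)])
  ultimately have "sorted_l1 m lam b - sorted_l1 m lam h \<le> (\<Sum>i<m. lam (\<pi> i) * (\<bar>b i\<bar> - \<bar>h i\<bar>))"
    by (simp add: right_diff_distrib sum_subtractf)
  \<comment> \<open>On the first \<open>k\<close> ranks the triangle inequality is used; beyond them
    \<open>b i = 0\<close>, so the difference is exactly \<open>- \<bar>d i\<bar>\<close>.\<close>
  also have "\<dots> \<le> (\<Sum>i\<in>?K. lam (\<pi> i) * \<bar>d i\<bar>) + (\<Sum>i\<in>?R. - (lam (\<pi> i) * \<bar>d i\<bar>))"
    unfolding split
  proof (intro add_mono sum_mono)
    fix i assume "i \<in> ?K"
    then show "lam (\<pi> i) * (\<bar>b i\<bar> - \<bar>h i\<bar>) \<le> lam (\<pi> i) * \<bar>d i\<bar>"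
      using range by (intro mult_left_mono lam0) (auto simp: d_def)
  next
    fix i assume "i \<in> ?R"
    then have "b i = 0" using supp[of i] by auto
    then show "lam (\<pi> i) * (\<bar>b i\<bar> - \<bar>h i\<bar>) \<le> - (lam (\<pi> i) * \<bar>d i\<bar>)" by (simp add: d_def)
  qed
  also have "(\<Sum>i\<in>?K. lam (\<pi> i) * \<bar>d i\<bar>) \<le> sqrt (\<Sum>j = 1..k. (lam j)\<^sup>2) * L2_set d ?K"
    by (rule sum_mult_le_l2norm[OF _ K]) simp
  also have "\<dots> \<le> ?B"
    unfolding l2norm_def L2_set_def
    by (intro mult_left_mono real_sqrt_le_mono sum_mono2) (auto simp: sum_nonneg)
  \<comment> \<open>To reach the full sorted norm of \<open>d\<close>, its first \<open>k\<close>
    terms are added back by Cauchy-Schwarz; they cost the second copy of \<open>?B\<close>.\<close>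
  also have "(\<Sum>i\<in>?R. - (lam (\<pi> i) * \<bar>d i\<bar>)) \<le> ?B - sorted_l1 m lam d"
  proof -
    have "(\<Sum>i\<in>?R. lam (\<pi> i) * sorted_abs m d (\<pi> i)) \<le> (\<Sum>i\<in>?R. lam (\<pi> i) * \<bar>d i\<bar>)"
    proof (intro sum_mono mult_left_mono lam0)
      fix i assume i: "i \<in> ?R"
      then have "b i = 0" using supp[of i] by auto
      then show "sorted_abs m d (\<pi> i) \<le> \<bar>d i\<bar>"
        using i M[of i] by (intro sorted_abs_le_of_order[OF \<pi>]) (auto simp: w)
    qed (use range in auto)
    moreover have "(\<Sum>i\<in>?K. lam (\<pi> i) * sorted_abs m d (\<pi> i)) \<le> ?B"
    proof -
      have "(\<Sum>i\<in>?K. lam (\<pi> i) * sorted_abs m d (\<pi> i)) = (\<Sum>j\<in>\<pi> ` ?K. lam j * sorted_abs m d j)"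
        by (simp add: sum.reindex[OF K(1)])
      also have "\<dots> = (\<Sum>j\<in>{1..k}. lam (id j) * \<bar>sorted_abs m d j\<bar>)"
        using \<open>k \<le> m\<close> unfolding K(2) by (intro sum.cong) (auto simp: sorted_abs_nonneg)
      also have "\<dots> \<le> sqrt (\<Sum>j = 1..k. (lam j)\<^sup>2) * L2_set (sorted_abs m d) {1..k}"
        by (rule sum_mult_le_l2norm) auto
      also have "L2_set (sorted_abs m d) {1..k} \<le> L2_set (sorted_abs m d) {1..m}"
        unfolding L2_set_def using \<open>k \<le> m\<close> by (intro real_sqrt_le_mono sum_mono2) auto
      also have "L2_set (sorted_abs m d) {1..m} = l2norm m d"
        unfolding L2_set_def l2norm_def using sum_sorted_abs[of "\<lambda>x. x\<^sup>2" m d] by simp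
      finally show ?thesis by (simp add: mult_left_mono sum_nonneg)
    qed
    ultimately show ?thesis
      unfolding sorted_l1_bij[OF \<pi>(1)] split by (simp add: sum_negf)
  qed
  finally show ?thesis by (simp add: d_def[abs_def] mult.commute)
qed

text \<open>The \<open>j\<close> largest entries each contribute at least the exponential of the
  \<open>j\<close>-th, so that exponential is at most \<open>8 * m / j\<close>. Logarithms then
  bound the square of the \<open>j\<close>-th entry by 8 times the squared weight, and
  \<open>8 \<le> 3^2\<close>.\<close>

lemma sorted_abs_le_slope_weights:
  assumes "\<sigma> > 0" "1 \<le> j" "j \<le> m"
    and a: "(\<Sum>i<m. exp (3 * (a i)\<^sup>2 / (8 * \<sigma>\<^sup>2))) \<le> 8 * real m"
  shows "sorted_abs m a j \<le> 3 * slope_weights \<sigma> m j"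
proof -
  let ?s = "sorted_abs m a" and ?f = "\<lambda>x. exp (3 * x\<^sup>2 / (8 * \<sigma>\<^sup>2))"
  have j: "0 < real j" "real j \<le> real m" using assms by auto
  have "real j * ?f (?s j) = (\<Sum>l = 1..j. ?f (?s j))" by simp
  also have "\<dots> \<le> (\<Sum>l = 1..j. ?f (?s l))"
    using assms by (intro sum_mono iffD2[OF exp_le_cancel_iff] divide_right_mono mult_left_mono power_mono)
      (auto intro: sorted_abs_antimono sorted_abs_nonneg)
  also have "\<dots> \<le> (\<Sum>l = 1..m. ?f (?s l))"
    using assms by (intro sum_mono2) auto
  also have "\<dots> = (\<Sum>i<m. ?f (a i))" by (subst sum_sorted_abs) simp
  also note a
  finally have "?f (?s j) \<le> 8 * real m / real j" using j by (simp add: field_simps)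
  then have "3 * (?s j)\<^sup>2 / (8 * \<sigma>\<^sup>2) \<le> ln (8 * real m / real j)"
    using j by (subst ln_ge_iff) auto
  \<comment> \<open>The cube absorbs the constant 8 because \<open>m / j \<ge> 1\<close>; its
    exponent 3 then cancels the 3 in the exponential moment.\<close>
  also have "\<dots> \<le> ln ((2 * real m / real j) ^ 3)"
  proof (rule ln_mono)
    have "1 \<le> (real m / real j)\<^sup>2" using j by (simp add: one_le_power)
    then have "8 * (real m / real j) * 1 \<le> 8 * (real m / real j) * (real m / real j)\<^sup>2"
      using j by (intro mult_left_mono) auto
    then show "8 * real m / real j \<le> (2 * real m / real j) ^ 3"
      by (simp add: power_divide power2_eq_square power3_eq_cube)
  qed (use j in auto)
  also have "\<dots> = 3 * ln (2 * real m / real j)"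
    using j by (simp add: ln_realpow)
  finally have *: "(?s j)\<^sup>2 \<le> 8 * \<sigma>\<^sup>2 * ln (2 * real m / real j)"
    using \<open>\<sigma> > 0\<close> by (simp add: field_simps)
  have L: "0 \<le> ln (2 * real m / real j)" using j by (intro ln_ge_zero) (simp add: field_simps)
  have "8 * \<sigma>\<^sup>2 * ln (2 * real m / real j) \<le> (3 * slope_weights \<sigma> m j)\<^sup>2"
    using L by (simp add: slope_weights_def power_mult_distrib mult_right_mono)
  with * have "(?s j)\<^sup>2 \<le> (3 * slope_weights \<sigma> m j)\<^sup>2" by simp
  then show ?thesis
    by (rule power2_le_imp_le) (use L \<open>\<sigma> > 0\<close> in \<open>simp add: slope_weights_def\<close>)
qed

section \<open>Exponential moments of Gaussian linear forms\<close>

text \<open>The factor 3/8 is chosen so that tilting turns the standard deviation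
  \<open>\<sigma>\<close> into \<open>2 * \<sigma>\<close>, as \<open>1/2 - 3/8 = 1/8\<close>. The
  integral is then the ratio 2 of the normalizing constants.\<close>

lemma nn_integral_exp_square_normal:
  assumes "\<sigma> > 0"
  shows "(\<integral>\<^sup>+x. ennreal (normal_density 0 \<sigma> x) * ennreal (exp (3 * x\<^sup>2 / (8 * \<sigma>\<^sup>2))) \<partial>lborel) = 2"
proof -
  have "normal_density 0 \<sigma> x * exp (3 * x\<^sup>2 / (8 * \<sigma>\<^sup>2)) = 2 * normal_density 0 (2 * \<sigma>) x" for x
  proof -
    have "- x\<^sup>2 / (2 * \<sigma>\<^sup>2) + 3 * x\<^sup>2 / (8 * \<sigma>\<^sup>2) = - x\<^sup>2 / (2 * (2 * \<sigma>)\<^sup>2)"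
      using assms by (simp add: field_simps)
    then have "exp (- x\<^sup>2 / (2 * \<sigma>\<^sup>2)) * exp (3 * x\<^sup>2 / (8 * \<sigma>\<^sup>2)) = exp (- x\<^sup>2 / (2 * (2 * \<sigma>)\<^sup>2))"
      by (simp only: exp_add[symmetric])
    moreover have "sqrt (2 * pi * (2 * \<sigma>)\<^sup>2) = 2 * sqrt (2 * pi * \<sigma>\<^sup>2)"
      using real_sqrt_mult[of "2\<^sup>2" "2 * pi * \<sigma>\<^sup>2"] by (simp add: power_mult_distrib)
    ultimately show ?thesis
      by (simp add: normal_density_def)
  qed
  then have "(\<integral>\<^sup>+x. ennreal (normal_density 0 \<sigma> x) * ennreal (exp (3 * x\<^sup>2 / (8 * \<sigma>\<^sup>2))) \<partial>lborel)
      = (\<integral>\<^sup>+x. 2 * ennreal (normal_density 0 (2 * \<sigma>) x) \<partial>lborel)"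
    by (intro nn_integral_cong) (simp add: ennreal_mult[symmetric] ennreal_mult')
  also have "\<dots> = 2 * (\<integral>\<^sup>+x. ennreal (normal_density 0 (2 * \<sigma>) x) \<partial>lborel)"
    by (rule nn_integral_cmult) measurable
  also have "(\<integral>\<^sup>+x. ennreal (normal_density 0 (2 * \<sigma>) x) \<partial>lborel) = 1"
    using assms by (subst nn_integral_eq_integral) auto
  finally show ?thesis by simp
qed

lemma distributed_gauss_noise_component:
  assumes "\<sigma> > 0" "i < n"
  shows "distributed (gauss_noise n \<sigma>) lborel (\<lambda>x. x i) (normal_density 0 \<sigma>)"
proof -
  have "distr (gauss_noise n \<sigma>) (density lborel (normal_density 0 \<sigma>)) (\<lambda>x. x i) = density lborel (normal_density 0 \<sigma>)"
    unfolding gauss_noise_def using assms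
    by (intro distr_PiM_component prob_space_normal_density) auto
  then have "distr (gauss_noise n \<sigma>) lborel (\<lambda>x. x i) = density lborel (normal_density 0 \<sigma>)"
    by (simp cong: distr_cong)
  then show ?thesis using assms measurable_gauss_noise_component[of i n \<sigma>] by (simp add: distributed_def)
qed

lemma indep_vars_gauss_noise:
  assumes "\<sigma> > 0" "n > 0"
  shows "prob_space.indep_vars (gauss_noise n \<sigma>) (\<lambda>_. borel) (\<lambda>i x. x i) {..<n}"
proof -
  interpret prob_space "gauss_noise n \<sigma>" by (rule prob_space_gauss_noise) fact
  let ?N = "density lborel (normal_density 0 \<sigma>)"
  have "indep_vars (\<lambda>_. ?N) (\<lambda>i x. x i) {..<n}"
  proof (subst indep_vars_iff_distr_eq_PiM')
    show "{..<n} \<noteq> {}" using assms by auto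
    show "random_variable ?N (\<lambda>x. x i)" if "i \<in> {..<n}" for i
      using that unfolding gauss_noise_def by (rule measurable_component_singleton)
    have "distr (gauss_noise n \<sigma>) (PiM {..<n} (\<lambda>_. ?N)) (\<lambda>x. \<lambda>i\<in>{..<n}. x i)
        = distr (gauss_noise n \<sigma>) (gauss_noise n \<sigma>) (\<lambda>x. x)"
      by (intro distr_cong) (auto simp: gauss_noise_def space_PiM)
    also have "\<dots> = PiM {..<n} (\<lambda>_. ?N)" by (simp add: gauss_noise_def)
    also have "\<dots> = PiM {..<n} (\<lambda>i. distr (gauss_noise n \<sigma>) ?N (\<lambda>x. x i))"
      unfolding gauss_noise_def using assms
      by (intro PiM_cong distr_PiM_component[symmetric] prob_space_normal_density) auto
    finally show "distr (gauss_noise n \<sigma>) (PiM {..<n} (\<lambda>_. ?N)) (\<lambda>x. \<lambda>i\<in>{..<n}. x i)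
        = PiM {..<n} (\<lambda>i. distr (gauss_noise n \<sigma>) ?N (\<lambda>x. x i))" .
  qed
  then show ?thesis
    by (rule indep_vars_compose2[where Y = "\<lambda>_ x. x"]) simp
qed

lemma distributed_gauss_noise_linear:
  assumes "\<sigma> > 0" and c: "(\<Sum>i<n. (c i)\<^sup>2) = 1"
  shows "distributed (gauss_noise n \<sigma>) lborel (\<lambda>x. \<Sum>i<n. c i * x i) (normal_density 0 \<sigma>)"
proof -
  interpret prob_space "gauss_noise n \<sigma>" by (rule prob_space_gauss_noise) fact
  \<comment> \<open>Vanishing coefficients are dropped because \<open>sum_indep_normal\<close> asks
    for positive standard deviations.\<close>
  let ?I = "{i \<in> {..<n}. c i \<noteq> 0}"
  have "?I \<noteq> {}"
  proof
    assume "?I = {}"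
    then have "(\<Sum>i<n. (c i)\<^sup>2) = 0" by (intro sum.neutral) auto
    then show False using c by simp
  qed
  then have "n > 0" by (cases n) auto
  have "distributed (gauss_noise n \<sigma>) lborel (\<lambda>x. \<Sum>i\<in>?I. c i * x i)
      (normal_density (\<Sum>i\<in>?I. 0) (sqrt (\<Sum>i\<in>?I. (\<bar>c i\<bar> * \<sigma>)\<^sup>2)))"
  proof (rule sum_indep_normal)
    show "indep_vars (\<lambda>i. borel) (\<lambda>i x. c i * x i) ?I"
      using indep_vars_subset[OF indep_vars_gauss_noise[OF \<open>\<sigma> > 0\<close> \<open>n > 0\<close>], of ?I]
      by (rule indep_vars_compose2[where Y = "\<lambda>i x. c i * x"]) auto
    fix i assume i: "i \<in> ?I"
    then show "0 < \<bar>c i\<bar> * \<sigma>" using \<open>\<sigma> > 0\<close> by simp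
    show "distributed (gauss_noise n \<sigma>) lborel (\<lambda>x. c i * x i) (normal_density 0 (\<bar>c i\<bar> * \<sigma>))"
      using normal_density_affine[OF distributed_gauss_noise_component[OF \<open>\<sigma> > 0\<close>, of i n] \<open>\<sigma> > 0\<close>,
          where \<alpha> = "c i" and \<beta> = 0] i
      by simp
  qed (use \<open>?I \<noteq> {}\<close> in auto)
  moreover have "(\<Sum>i\<in>?I. c i * x i) = (\<Sum>i<n. c i * x i)" for x :: "nat \<Rightarrow> real"
    by (rule sum.mono_neutral_left) auto
  moreover have "(\<Sum>i\<in>?I. (\<bar>c i\<bar> * \<sigma>)\<^sup>2) = (\<Sum>i<n. (c i)\<^sup>2 * \<sigma>\<^sup>2)"
    by (rule sum.mono_neutral_cong_left) (auto simp: power_mult_distrib)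
  ultimately show ?thesis
    using \<open>\<sigma> > 0\<close> c by (simp add: sum_distrib_right[symmetric])
qed

text \<open>Each term has mean 2, since a unit vector gives a linear form of variance
  \<open>\<sigma>^2\<close>, and Markov's inequality at level \<open>8 * m\<close> yields 1/4. Two
  such events leave probability at least 1/2.\<close>

lemma prob_sum_exp_square_le:
  assumes "\<sigma> > 0" "m > 0" and c: "\<And>j. j < m \<Longrightarrow> (\<Sum>i<n. (c j i)\<^sup>2) = 1"
  defines "f \<equiv> \<lambda>x. \<Sum>j<m. exp (3 * (\<Sum>i<n. c j i * x i)\<^sup>2 / (8 * \<sigma>\<^sup>2))"
  shows "{x \<in> space (gauss_noise n \<sigma>). f x > 8 * real m} \<in> sets (gauss_noise n \<sigma>)"
    and "measure (gauss_noise n \<sigma>) {x \<in> space (gauss_noise n \<sigma>). f x > 8 * real m} \<le> 1 / 4"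
proof -
  let ?G = "gauss_noise n \<sigma>"
  interpret prob_space ?G by (rule prob_space_gauss_noise) fact
  have f[measurable]: "f \<in> borel_measurable ?G"
    unfolding f_def using measurable_gauss_noise_component[measurable] by measurable
  show "{x \<in> space ?G. f x > 8 * real m} \<in> sets ?G" by measurable
  have "(\<integral>\<^sup>+x. ennreal (exp (3 * (\<Sum>i<n. c j i * x i)\<^sup>2 / (8 * \<sigma>\<^sup>2))) \<partial>?G) = 2" if "j < m" for j
    using distributed_nn_integral[OF distributed_gauss_noise_linear[OF \<open>\<sigma> > 0\<close> c[OF that]],
        of "\<lambda>x. ennreal (exp (3 * x\<^sup>2 / (8 * \<sigma>\<^sup>2)))"] nn_integral_exp_square_normal[OF \<open>\<sigma> > 0\<close>]
    by simp
  then have "(\<integral>\<^sup>+x. ennreal (f x) \<partial>?G) = (\<Sum>j<m. 2)"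
    unfolding f_def by (subst sum_ennreal[symmetric], simp) (subst nn_integral_sum, use measurable_gauss_noise_component[measurable] in auto)
  then have int: "(\<integral>\<^sup>+x. ennreal (f x) \<partial>?G) = ennreal (2 * real m)"
    by (simp add: ennreal_mult ennreal_of_nat_eq_real_of_nat mult.commute)
  have "emeasure ?G {x \<in> space ?G. f x > 8 * real m}
      \<le> emeasure ?G {x \<in> space ?G. 1 \<le> ennreal (1 / (8 * real m)) * ennreal (f x)}"
  proof (intro emeasure_mono subsetI)
    fix x assume "x \<in> {x \<in> space ?G. f x > 8 * real m}"
    then have "x \<in> space ?G" "1 \<le> 1 / (8 * real m) * f x" using \<open>m > 0\<close> by (auto simp: field_simps)
    then show "x \<in> {x \<in> space ?G. 1 \<le> ennreal (1 / (8 * real m)) * ennreal (f x)}"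
      by (simp add: ennreal_mult'[symmetric])
  qed measurable
  also have "\<dots> \<le> ennreal (1 / (8 * real m)) * (\<integral>\<^sup>+x. ennreal (f x) * indicator (space ?G) x \<partial>?G)"
    by (rule nn_integral_Markov_inequality) measurable
  also have "(\<integral>\<^sup>+x. ennreal (f x) * indicator (space ?G) x \<partial>?G) = (\<integral>\<^sup>+x. ennreal (f x) \<partial>?G)"
    by (rule nn_integral_cong) simp
  also have "ennreal (1 / (8 * real m)) * (\<integral>\<^sup>+x. ennreal (f x) \<partial>?G) = ennreal (1 / 4)"
    unfolding int using \<open>m > 0\<close> by (simp add: ennreal_mult[symmetric])
  finally show "prob {x \<in> space ?G. f x > 8 * real m} \<le> 1 / 4"
    by (simp add: emeasure_eq_measure)
qed

section \<open>The error bound\<close>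

lemma slope_weights_log_pos:
  assumes "1 \<le> j" "j \<le> m"
  shows "0 < ln (2 * real m / real j)"
  using assms by (simp add: ln_gt_zero_iff field_simps)

lemma slope_weights_pos: "\<sigma> > 0 \<Longrightarrow> 1 \<le> j \<Longrightarrow> j \<le> m \<Longrightarrow> 0 < slope_weights \<sigma> m j"
  using slope_weights_log_pos[of j m] by (simp add: slope_weights_def)

lemma slope_weights_nonneg: "\<sigma> > 0 \<Longrightarrow> 1 \<le> j \<Longrightarrow> j \<le> m \<Longrightarrow> 0 \<le> slope_weights \<sigma> m j"
  using slope_weights_pos by (rule less_imp_le)

lemma slope_weights_antimono:
  "\<sigma> > 0 \<Longrightarrow> 1 \<le> i \<Longrightarrow> i \<le> j \<Longrightarrow> j \<le> m \<Longrightarrow> slope_weights \<sigma> m j \<le> slope_weights \<sigma> m i"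
  unfolding slope_weights_def
  by (intro mult_left_mono real_sqrt_le_mono ln_mono divide_left_mono) auto

lemma slope_weights_power2:
  assumes "1 \<le> j" "j \<le> m"
  shows "(slope_weights \<sigma> m j)\<^sup>2 = \<sigma>\<^sup>2 * ln (2 * real m / real j)"
  using slope_weights_log_pos[OF assms] by (simp add: slope_weights_def power_mult_distrib)

lemma slope_weights_last: "1 \<le> m \<Longrightarrow> slope_weights \<sigma> m m = \<sigma> * sqrt (ln 2)"
  by (simp add: slope_weights_def)

lemma sum_slope_weights_ge:
  assumes "\<sigma> > 0" "1 \<le> k" "k \<le> m"
  shows "\<sigma>\<^sup>2 * (real k * ln (2 * real m / real k)) \<le> (\<Sum>j = 1..k. (slope_weights \<sigma> m j)\<^sup>2)"
proof -
  have "(\<Sum>j = 1..k. (slope_weights \<sigma> m k)\<^sup>2) \<le> (\<Sum>j = 1..k. (slope_weights \<sigma> m j)\<^sup>2)"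
    using assms slope_weights_pos[OF assms]
    by (intro sum_mono power_mono slope_weights_antimono) auto
  then show ?thesis
    using assms by (simp add: slope_weights_power2 mult.left_commute)
qed

text \<open>Elementary Stirling lower bound for \<open>ln (k!)\<close>, by induction with
  \<open>ln (1 + 1 / k) \<le> 1 / k\<close>.\<close>

lemma mult_ln_minus_le_sum_ln: "real k * ln (real k) - real k \<le> (\<Sum>j = 1..k. ln (real j))"
proof (induction k)
  case (Suc k)
  show ?case
  proof (cases "k = 0")
    case False
    then have k: "0 < real k" by simp
    have "ln (1 + 1 / real k) \<le> 1 / real k" using k by (intro ln_add_one_self_le_self) simp
    moreover have "real (Suc k) = real k * (1 + 1 / real k)" using k by (simp add: field_simps)
    then have "ln (real (Suc k)) = ln (real k) + ln (1 + 1 / real k)"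
      using ln_mult_pos[of "real k" "1 + 1 / real k"] k by (simp only:) (simp add: add_pos_pos)
    ultimately have "ln (real (Suc k)) \<le> ln (real k) + 1 / real k" by simp
    then have "real k * ln (real (Suc k)) \<le> real k * (ln (real k) + 1 / real k)"
      using k by (intro mult_left_mono) auto
    then have "real k * ln (real (Suc k)) \<le> real k * ln (real k) + 1"
      using k by (simp add: distrib_left)
    then show ?thesis using Suc.IH by (simp add: algebra_simps)
  qed simp
qed simp

text \<open>Stirling's bound supplies an extra \<open>k\<close>, which appears as the factor
  \<open>e\<close> inside the logarithm.\<close>

lemma sum_slope_weights_le:
  assumes "1 \<le> k" "k \<le> m"
  shows "(\<Sum>j = 1..k. (slope_weights \<sigma> m j)\<^sup>2) \<le> \<sigma>\<^sup>2 * (real k * ln (2 * exp 1 * real m / real k))"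
proof -
  have "(\<Sum>j = 1..k. (slope_weights \<sigma> m j)\<^sup>2) = \<sigma>\<^sup>2 * (\<Sum>j = 1..k. ln (2 * real m) - ln (real j))"
    unfolding sum_distrib_left using assms
    by (intro sum.cong) (auto simp: slope_weights_power2 ln_div)
  also have "\<dots> = \<sigma>\<^sup>2 * (real k * ln (2 * real m) - (\<Sum>j = 1..k. ln (real j)))"
    by (simp add: sum_subtractf)
  also have "\<dots> \<le> \<sigma>\<^sup>2 * (real k * ln (2 * real m) - (real k * ln (real k) - real k))"
    by (intro mult_left_mono diff_left_mono mult_ln_minus_le_sum_ln) auto
  also have "real k * ln (2 * real m) - (real k * ln (real k) - real k)
      = real k * ln (2 * exp 1 * real m / real k)"
    using assms by (simp add: ln_div ln_mult algebra_simps)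
  finally show ?thesis .
qed

section \<open>Prediction error: basic inequality and control of the noise term\<close>

lemma sorted_l1_nonneg:
  "(\<And>j. 1 \<le> j \<Longrightarrow> j \<le> m \<Longrightarrow> 0 \<le> lam j) \<Longrightarrow> 0 \<le> sorted_l1 m lam u"
  unfolding sorted_l1_def by (intro sum_nonneg mult_nonneg_nonneg) (auto intro: sorted_abs_nonneg)

lemma matvec_diff: "matvec p X (\<lambda>j. b j - c j) i = matvec p X b i - matvec p X c i"
  by (simp add: matvec_def right_diff_distrib sum_subtractf)

lemma inner_n_matvec: "inner_n n a (matvec p X b) = inner_n p (\<lambda>j. \<Sum>i<n. X i j * a i) b"
proof -
  have "inner_n n a (matvec p X b) = (\<Sum>i<n. \<Sum>j<p. X i j * a i * b j)"
    by (simp add: inner_n_def matvec_def sum_distrib_left ac_simps)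
  also have "\<dots> = (\<Sum>j<p. \<Sum>i<n. X i j * a i * b j)" by (rule sum.swap)
  finally show ?thesis by (simp add: inner_n_def sum_distrib_right)
qed

lemma inner_n_le_l2norm: "inner_n n x y \<le> l2norm n x * l2norm n y"
proof -
  have "inner_n n x y \<le> (\<Sum>i<n. \<bar>x i\<bar> * \<bar>y i\<bar>)"
    unfolding inner_n_def by (intro sum_mono) (simp add: abs_mult[symmetric])
  also have "\<dots> \<le> l2norm n x * l2norm n y"
    unfolding l2norm_eq_L2_set by (rule L2_set_mult_ineq)
  finally show ?thesis .
qed

lemma inner_n_add_right: "inner_n n x (\<lambda>i. y i + z i) = inner_n n x y + inner_n n x z"
  by (simp add: inner_n_def distrib_left sum.distrib)

lemma inner_n_diff_left: "inner_n n (\<lambda>i. x i - y i) z = inner_n n x z - inner_n n y z"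
  by (simp add: inner_n_def left_diff_distrib sum_subtractf)

lemma l2norm_add_power2:
  "(l2norm n (\<lambda>i. x i + y i))\<^sup>2 = (l2norm n x)\<^sup>2 + 2 * inner_n n x y + (l2norm n y)\<^sup>2"
  by (simp add: l2norm_power2 inner_n_def power2_sum sum.distrib sum_distrib_left algebra_simps)

text \<open>The objective at the estimator is compared with its value at the true pair. The residual
  is \<open>e - v\<close>, and the terms in \<open>e\<close> alone cancel after the square is
  expanded.\<close>

lemma mshift_basic_inequality:
  assumes "is_mshift_min n p X (\<lambda>i. matvec p X bs i + ms i + e i) \<rho> lt l bh mh"
  defines "v \<equiv> \<lambda>i. matvec p X (\<lambda>j. bh j - bs j) i + (mh i - ms i)"
  shows "(l2norm n v)\<^sup>2 \<le> 2 * inner_n n e v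
    + 2 * \<rho> * (sorted_l1 p lt bs - sorted_l1 p lt bh) + 2 * \<rho> * (sorted_l1 n l ms - sorted_l1 n l mh)"
proof -
  have "matvec p X bs i + ms i + e i - matvec p X bh i - mh i = e i - v i" for i
    by (simp add: v_def matvec_diff)
  moreover have "matvec p X bs i + ms i + e i - matvec p X bs i - ms i = e i" for i by simp
  moreover have "mshift_obj n p X (\<lambda>i. matvec p X bs i + ms i + e i) \<rho> lt l bh mh
      \<le> mshift_obj n p X (\<lambda>i. matvec p X bs i + ms i + e i) \<rho> lt l bs ms"
    using assms(1) unfolding is_mshift_min_def by blast
  ultimately have "(\<Sum>i<n. (e i - v i)\<^sup>2) + 2 * \<rho> * sorted_l1 p lt bh + 2 * \<rho> * sorted_l1 n l mh
      \<le> (\<Sum>i<n. (e i)\<^sup>2) + 2 * \<rho> * sorted_l1 p lt bs + 2 * \<rho> * sorted_l1 n l ms"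
    by (simp only: mshift_obj_def)
  moreover have "(\<Sum>i<n. (e i - v i)\<^sup>2) = (\<Sum>i<n. (e i)\<^sup>2) - 2 * inner_n n e v + (l2norm n v)\<^sup>2"
    by (simp add: l2norm_power2 inner_n_def power2_diff sum.distrib sum_subtractf sum_distrib_left algebra_simps)
  ultimately show ?thesis by (simp add: algebra_simps)
qed

text \<open>The noise is split as \<open>a + (e - a)\<close>. The correlations of \<open>a\<close>
  with the columns of \<open>X\<close> and of the identity are below three times the weights, which
  duality turns into sorted norms; Cauchy-Schwarz handles the short remainder.\<close>

lemma noise_inner_le:
  fixes b m :: "nat \<Rightarrow> real"
  assumes "\<sigma> > 0"
    and aX: "(\<Sum>j<p. exp (3 * (\<Sum>i<n. X i j * a i)\<^sup>2 / (8 * \<sigma>\<^sup>2))) \<le> 8 * real p"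
    and aI: "(\<Sum>i<n. exp (3 * (a i)\<^sup>2 / (8 * \<sigma>\<^sup>2))) \<le> 8 * real n"
    and near: "l2norm n (\<lambda>i. e i - a i) \<le> R"
  defines "v \<equiv> \<lambda>i. matvec p X b i + m i"
  shows "inner_n n e v \<le> 3 * (sorted_l1 p (slope_weights \<sigma> p) b + sorted_l1 n (slope_weights \<sigma> n) m)
    + R * l2norm n v"
proof -
  have "inner_n n a (matvec p X b) \<le> 3 * sorted_l1 p (slope_weights \<sigma> p) b"
    unfolding inner_n_matvec using assms
    by (intro inner_le_sorted_l1 slope_weights_antimono sorted_abs_le_slope_weights) auto
  moreover have "inner_n n a m \<le> 3 * sorted_l1 n (slope_weights \<sigma> n) m"
    using assms by (intro inner_le_sorted_l1 slope_weights_antimono sorted_abs_le_slope_weights) auto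
  moreover have "inner_n n (\<lambda>i. e i - a i) v \<le> R * l2norm n v"
    using inner_n_le_l2norm[of n "\<lambda>i. e i - a i" v] mult_right_mono[OF near, of "l2norm n v"] by simp
  moreover have "inner_n n a v = inner_n n a (matvec p X b) + inner_n n a m"
    unfolding v_def by (rule inner_n_add_right)
  ultimately show ?thesis by (simp add: inner_n_diff_left)
qed

text \<open>Here \<open>b\<close> and \<open>m\<close> stand for the error norms, \<open>V\<close>
  for the prediction error, \<open>J\<close> for the total sorted norm, and \<open>x\<close>,
  \<open>z\<close> for the Euclidean norms of the leading weights. The penalty outweighs the noise,
  so \<open>J\<close> drops out and a quadratic inequality for \<open>y\<close> remains.\<close>

lemma error_bound_in_cone:
  fixes b m V J R x z \<rho> \<kappa> :: real
  assumes "0 \<le> b" "0 \<le> m" "0 \<le> J" "10 \<le> \<rho>" "0 < \<kappa>" "\<kappa> \<le> 1" "0 \<le> x" "0 \<le> z"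
    and V: "V\<^sup>2 \<le> 6 * J + 2 * (R * V) + 2 * \<rho> * (2 * (x * b + z * m) - J)"
    and RE: "\<kappa>\<^sup>2 * (b\<^sup>2 + m\<^sup>2) \<le> V\<^sup>2" and R: "R\<^sup>2 \<le> 48 * (x\<^sup>2 + z\<^sup>2)"
  shows "b\<^sup>2 + m\<^sup>2 \<le> (64 * \<rho>\<^sup>2 + 384) / \<kappa> ^ 4 * (x\<^sup>2 + z\<^sup>2)"
proof -
  define L where "L = sqrt (x\<^sup>2 + z\<^sup>2)"
  define D where "D = sqrt (b\<^sup>2 + m\<^sup>2)"
  define y where "y = \<kappa>\<^sup>2 * D"
  have L: "L\<^sup>2 = x\<^sup>2 + z\<^sup>2" and D: "D\<^sup>2 = b\<^sup>2 + m\<^sup>2" by (simp_all add: L_def D_def)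
  have "0 \<le> L" "0 \<le> D" by (simp_all add: L_def D_def)
  have W: "x * b + z * m \<le> L * D"
  proof (rule power2_le_imp_le)
    have "0 \<le> (x * m - z * b)\<^sup>2" by simp
    then show "(x * b + z * m)\<^sup>2 \<le> (L * D)\<^sup>2"
      by (simp add: power_mult_distrib L D power2_sum power2_diff algebra_simps)
  qed (use \<open>0 \<le> L\<close> \<open>0 \<le> D\<close> in simp)
  \<comment> \<open>Half of \<open>V^2\<close> absorbs the term \<open>2 * R * V\<close> at the
    price \<open>2 * R^2\<close>; after doubling, \<open>4 * R^2\<close> becomes
    \<open>192 * L^2\<close>.\<close>
  have "0 \<le> (V - 2 * R)\<^sup>2" by simp
  then have "2 * (R * V) \<le> V\<^sup>2 / 2 + 2 * R\<^sup>2" by (simp add: power2_diff algebra_simps)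
  moreover have "6 * J \<le> 2 * \<rho> * J" using assms by (intro mult_right_mono) auto
  moreover have "4 * \<rho> * (x * b + z * m) \<le> 4 * \<rho> * (L * D)" using W assms by (intro mult_left_mono) auto
  ultimately have "V\<^sup>2 \<le> 8 * \<rho> * (L * D) + 192 * L\<^sup>2" using V R L by (simp add: algebra_simps)
  then have "\<kappa>\<^sup>2 * D\<^sup>2 \<le> 8 * \<rho> * (L * D) + 192 * L\<^sup>2" using RE D by simp
  \<comment> \<open>One more factor \<open>\<kappa>^2\<close> makes the inequality quadratic in
    \<open>y\<close>. Completing the square gives \<open>32 * \<rho>^2 + 192\<close>, doubled when
    \<open>y^2 / 2\<close> is absorbed.\<close>
  then have "\<kappa>\<^sup>2 * (\<kappa>\<^sup>2 * D\<^sup>2) \<le> \<kappa>\<^sup>2 * (8 * \<rho> * (L * D) + 192 * L\<^sup>2)"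
    by (rule mult_left_mono) simp
  then have "y\<^sup>2 \<le> 8 * \<rho> * L * y + \<kappa>\<^sup>2 * (192 * L\<^sup>2)"
    by (simp add: y_def power_mult_distrib power2_eq_square algebra_simps)
  moreover have "\<kappa>\<^sup>2 * (192 * L\<^sup>2) \<le> 1 * (192 * L\<^sup>2)"
    using assms by (intro mult_right_mono) (auto simp: power_le_one)
  moreover have "0 \<le> (y - 8 * \<rho> * L)\<^sup>2" by simp
  then have "8 * \<rho> * L * y \<le> y\<^sup>2 / 2 + 32 * \<rho>\<^sup>2 * L\<^sup>2"
    by (simp add: power2_diff power_mult_distrib algebra_simps)
  ultimately have "y\<^sup>2 \<le> (64 * \<rho>\<^sup>2 + 384) * L\<^sup>2" by (simp add: algebra_simps)
  moreover have "y\<^sup>2 = \<kappa> ^ 4 * D\<^sup>2" by (simp add: y_def power_mult_distrib flip: power_mult)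
  ultimately show ?thesis using \<open>0 < \<kappa>\<close> by (simp add: L D field_simps)
qed

text \<open>Since \<open>x * b + z * m\<close> is at most \<open>J / 5\<close>, the penalty term is
  negative enough to bound \<open>J\<close>, and then each error norm, by the noise radius
  \<open>R\<close>.\<close>

lemma error_bound_outside_cone:
  fixes b m V J R x z \<rho> :: real
  assumes "0 \<le> b" "0 \<le> m" "10 \<le> \<rho>" "0 < x" "0 < z" "0 \<le> R"
    and V: "V\<^sup>2 \<le> 6 * J + 2 * (R * V) + 2 * \<rho> * (2 * (x * b + z * m) - J)"
    and cone: "5 * (x * b + z * m) \<le> J" and R: "R\<^sup>2 \<le> 48 * x\<^sup>2" "R\<^sup>2 \<le> 48 * z\<^sup>2"
  shows "b\<^sup>2 + m\<^sup>2 \<le> 48 * (x\<^sup>2 + z\<^sup>2)"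
proof -
  let ?W = "x * b + z * m"
  have nn: "0 \<le> x * b" "0 \<le> z * m" using assms by auto
  then have "0 \<le> J" using cone by (simp add: distrib_left)
  have "2 * (R * V) \<le> V\<^sup>2 + R\<^sup>2" using sum_squares_bound[of R V] by (simp add: power2_eq_square)
  then have "2 * \<rho> * J - 6 * J \<le> 4 * \<rho> * ?W + R\<^sup>2" using V by (simp add: algebra_simps)
  moreover have "4 * \<rho> * ?W \<le> 4 * \<rho> * (J / 5)" using cone assms by (intro mult_left_mono) auto
  \<comment> \<open>After collecting terms the coefficient of \<open>J\<close> is
    \<open>6 * \<rho> / 5 - 6\<close>, which is at least 6 because
    \<open>\<rho> \<ge> 10\<close>.\<close>
  moreover have "(12 / 10 * 10) * J \<le> 12 / 10 * \<rho> * J" using \<open>0 \<le> J\<close> assms(3) by (intro mult_right_mono) auto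
  ultimately have "6 * J \<le> R\<^sup>2" by (simp add: algebra_simps)
  then have W: "7 * ?W \<le> R\<^sup>2" using cone nn by simp
  \<comment> \<open>The constant 7 has square at least 48; used both here and in
    \<open>7 * ?W\<close>, it cancels when each error norm is compared with
    \<open>R\<close>.\<close>
  have "R \<le> 7 * y" if "0 < y" "R\<^sup>2 \<le> 48 * y\<^sup>2" for y
  proof (rule power2_le_imp_le)
    have "48 * y\<^sup>2 \<le> (7 * y)\<^sup>2" by (simp add: power_mult_distrib)
    then show "R\<^sup>2 \<le> (7 * y)\<^sup>2" using that(2) by (rule order_trans[rotated])
  qed (use that in simp)
  then have Rx: "R \<le> 7 * x" "R \<le> 7 * z" using assms by auto
  have bound: "t\<^sup>2 \<le> R\<^sup>2" if "0 \<le> t" "0 < y" "7 * (y * t) \<le> R\<^sup>2" "R \<le> 7 * y" for t y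
  proof -
    have "R\<^sup>2 \<le> 7 * y * R"
      using mult_right_mono[OF that(4) \<open>0 \<le> R\<close>] by (simp add: power2_eq_square)
    then have "y * t \<le> y * R" using that(3) by (simp add: ac_simps)
    then have "t \<le> R" using \<open>0 < y\<close> by simp
    then show ?thesis using that(1) by (rule power_mono)
  qed
  have W': "7 * (x * b) \<le> R\<^sup>2" "7 * (z * m) \<le> R\<^sup>2" using W nn unfolding distrib_left by linarith+
  have "b\<^sup>2 \<le> R\<^sup>2" by (rule bound[of b x]) (use assms W' Rx in auto)
  moreover have "m\<^sup>2 \<le> R\<^sup>2" by (rule bound[of m z]) (use assms W' Rx in auto)
  ultimately show ?thesis using R unfolding distrib_left by linarith
qed

section \<open>Sorted norm of simple vectors and normalization of the cone condition\<close>

lemma sorted_l1_unit_le: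
  assumes "1 \<le> m" and anti: "\<And>i j. 1 \<le> i \<Longrightarrow> i \<le> j \<Longrightarrow> j \<le> m \<Longrightarrow> lam j \<le> lam i"
  shows "sorted_l1 m lam (\<lambda>i. if i = 0 then 1 else 0) \<le> lam 1"
proof -
  let ?u = "\<lambda>i :: nat. if i = 0 then 1 else 0 :: real"
  obtain \<pi> where \<pi>: "bij_betw \<pi> {..<m} {1..m}" "\<And>i. i < m \<Longrightarrow> sorted_abs m ?u (\<pi> i) = \<bar>?u i\<bar>"
    using sorted_abs_bij[of m ?u] by blast
  have "sorted_l1 m lam ?u = (\<Sum>i<m. if i = 0 then lam (\<pi> i) else 0)"
    unfolding sorted_l1_bij[OF \<pi>(1)] by (intro sum.cong) (auto simp: \<pi>(2))
  also have "\<dots> = lam (\<pi> 0)" using \<open>1 \<le> m\<close> by (simp add: sum.delta)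
  also have "\<dots> \<le> lam 1"
  proof -
    have "\<pi> 0 \<in> {1..m}" using \<pi>(1) \<open>1 \<le> m\<close> by (auto simp: bij_betw_def)
    then show ?thesis using anti[of 1 "\<pi> 0"] by simp
  qed
  finally show ?thesis .
qed

lemma sorted_l1_zero: "sorted_l1 m lam (\<lambda>_. 0) = 0"
proof -
  obtain \<pi> where \<pi>: "bij_betw \<pi> {..<m} {1..m}" "\<And>i. i < m \<Longrightarrow> sorted_abs m (\<lambda>_. 0) (\<pi> i) = \<bar>0 :: real\<bar>"
    using sorted_abs_bij[of m "\<lambda>_. 0"] by blast
  show ?thesis unfolding sorted_l1_bij[OF \<pi>(1)] by (simp add: \<pi>(2))
qed

text \<open>Both weight sequences end in the same value \<open>\<sigma> * sqrt (ln 2)\<close>, so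
  multiplying by it clears the normalizations and the \<open>ln 2\<close> under the roots
  together.\<close>

lemma cone_condition_iff:
  assumes "\<sigma> > 0" "1 \<le> p" "1 \<le> n" "1 \<le> k" "k \<le> p" "1 \<le> s" "s \<le> n"
  shows "(\<Sum>j = 1..p. slope_weights \<sigma> p j / slope_weights \<sigma> p p * sorted_abs p b j)
      + (\<Sum>j = 1..n. slope_weights \<sigma> n j / slope_weights \<sigma> n n * sorted_abs n m j)
      \<le> 5 * (sqrt (real k * ln (2 * exp 1 * real p / real k) / ln 2) * B
          + sqrt (real s * ln (2 * exp 1 * real n / real s) / ln 2) * M)
    \<longleftrightarrow> sorted_l1 p (slope_weights \<sigma> p) b + sorted_l1 n (slope_weights \<sigma> n) m
      \<le> 5 * (\<sigma> * sqrt (real k * ln (2 * exp 1 * real p / real k)) * B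
          + \<sigma> * sqrt (real s * ln (2 * exp 1 * real n / real s)) * M)" (is "?l \<longleftrightarrow> ?r")
proof -
  have "0 < \<sigma> * sqrt (ln 2)" using assms by simp
  have "(\<Sum>j = 1..p. slope_weights \<sigma> p j / slope_weights \<sigma> p p * sorted_abs p b j)
      = sorted_l1 p (slope_weights \<sigma> p) b / (\<sigma> * sqrt (ln 2))"
    using assms by (simp add: sorted_l1_def slope_weights_last sum_divide_distrib)
  moreover have "(\<Sum>j = 1..n. slope_weights \<sigma> n j / slope_weights \<sigma> n n * sorted_abs n m j)
      = sorted_l1 n (slope_weights \<sigma> n) m / (\<sigma> * sqrt (ln 2))"
    using assms by (simp add: sorted_l1_def slope_weights_last sum_divide_distrib)
  moreover have "sqrt (t / ln 2) = \<sigma> * sqrt t / (\<sigma> * sqrt (ln 2))" for t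
    using assms by (simp add: real_sqrt_divide)
  moreover have "u / \<tau> + v / \<tau> \<le> 5 * (x / \<tau> * B + y / \<tau> * M) \<longleftrightarrow> u + v \<le> 5 * (x * B + y * M)"
    if "0 < \<tau>" for u v x y \<tau> :: real
  proof -
    have "5 * (x / \<tau> * B + y / \<tau> * M) = 5 * (x * B + y * M) / \<tau>"
      by (simp add: add_divide_distrib distrib_left)
    then show ?thesis using that by (simp only: add_divide_distrib[symmetric] divide_le_cancel) auto
  qed
  ultimately show ?thesis
    using \<open>0 < \<sigma> * sqrt (ln 2)\<close> by (simp only:)
qed

section \<open>Deterministic error bound and its probability under the restricted eigenvalue
  condition\<close>

context
  fixes n p k s :: nat and X :: "nat \<Rightarrow> nat \<Rightarrow> real" and \<sigma> \<kappa>1 \<kappa>2 :: real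
  assumes dims: "1 \<le> k" "k \<le> p" "1 \<le> s" "s \<le> n" and \<sigma>: "0 < \<sigma>"
    and cols: "\<And>j. j < p \<Longrightarrow> (\<Sum>i<n. (X i j)\<^sup>2) = 1"
    and \<kappa>: "2 * \<kappa>2 < \<kappa>1" "0 < 2 * \<kappa>2"
    and RE: "\<And>b m. sorted_l1 p (slope_weights \<sigma> p) b + sorted_l1 n (slope_weights \<sigma> n) m
      \<le> 5 * (\<sigma> * sqrt (real k * ln (2 * exp 1 * real p / real k)) * l2norm p b
          + \<sigma> * sqrt (real s * ln (2 * exp 1 * real n / real s)) * l2norm n m)
      \<Longrightarrow> (l2norm n (matvec p X b))\<^sup>2 + (l2norm n m)\<^sup>2 \<ge> \<kappa>1 * ((l2norm p b)\<^sup>2 + (l2norm n m)\<^sup>2)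
        \<and> \<bar>inner_n n (matvec p X b) m\<bar> \<le> \<kappa>2 * ((l2norm p b)\<^sup>2 + (l2norm n m)\<^sup>2)"
begin

text \<open>The first coordinate vector of \<open>\<beta>\<close>-space lies in the cone, and its image is a unit column.\<close>

lemma restricted_eigenvalue_le_1: "\<kappa>1 \<le> 1"
proof -
  let ?e = "\<lambda>i :: nat. if i = 0 then 1 else 0 :: real"
  have p: "1 \<le> p" using dims by simp
  have e: "l2norm p ?e = 1"
    using p by (simp add: l2norm_def if_distrib[of "\<lambda>x. x\<^sup>2"] sum.delta cong: if_cong)
  have z: "l2norm n (\<lambda>_. 0) = 0" by (simp add: l2norm_def)
  \<comment> \<open>The first weight is at most the cone width, by
    \<open>ln (2 * p) = ln (2 * p / k) + ln k\<close> and \<open>ln k \<le> k\<close>; this puts the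
    coordinate vector into the cone.\<close>
  have K: "slope_weights \<sigma> p 1 \<le> \<sigma> * sqrt (real k * ln (2 * exp 1 * real p / real k))"
    unfolding slope_weights_def
  proof (intro mult_left_mono real_sqrt_le_mono)
    have k: "1 \<le> real k" using dims by simp
    have "ln (2 * real p / real 1) = ln (2 * real p / real k) + ln (real k)"
      using dims by (simp add: ln_div ln_mult)
    also have "\<dots> \<le> real k * ln (2 * real p / real k) + real k"
    proof (rule add_mono)
      show "ln (real k) \<le> real k" using ln_le_minus_one[of "real k"] k by simp
      show "ln (2 * real p / real k) \<le> real k * ln (2 * real p / real k)"
        using k slope_weights_log_pos[of k p] dims by simp
    qed
    also have "\<dots> = real k * ln (2 * exp 1 * real p / real k)"
      using dims by (simp add: ln_div ln_mult algebra_simps)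
    finally show "ln (2 * real p / real 1) \<le> real k * ln (2 * exp 1 * real p / real k)" .
  qed (use \<sigma> in simp)
  have "sorted_l1 p (slope_weights \<sigma> p) ?e \<le> slope_weights \<sigma> p 1"
    by (rule sorted_l1_unit_le[OF p]) (rule slope_weights_antimono[OF \<sigma>])
  also have "\<dots> \<le> 5 * (\<sigma> * sqrt (real k * ln (2 * exp 1 * real p / real k)))"
    using K slope_weights_pos[OF \<sigma> order_refl p] by linarith
  finally have "\<kappa>1 * ((l2norm p ?e)\<^sup>2 + (l2norm n (\<lambda>_. 0))\<^sup>2)
      \<le> (l2norm n (matvec p X ?e))\<^sup>2 + (l2norm n (\<lambda>_. 0))\<^sup>2"
    by (intro conjunct1[OF RE]) (simp add: sorted_l1_zero e z)
  moreover have "matvec p X ?e = (\<lambda>i. X i 0)"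
    using p by (auto simp: matvec_def if_distrib sum.delta fun_eq_iff cong: if_cong)
  ultimately show ?thesis using cols[of 0] p by (simp add: e z l2norm_power2)
qed

text \<open>The noise enters deterministically, through a point \<open>a\<close> with controlled
  exponential sums at distance at most \<open>R\<close>. The basic inequality feeds one of the two
  scalar bounds, according to whether the error lies in the cone.\<close>

lemma mshift_error_bound:
  assumes \<rho>: "10 \<le> \<rho>" and sparse: "l0 p bs \<le> k" "l0 n ms \<le> s"
    and aX: "(\<Sum>j<p. exp (3 * (\<Sum>i<n. X i j * a i)\<^sup>2 / (8 * \<sigma>\<^sup>2))) \<le> 8 * real p"
    and aI: "(\<Sum>i<n. exp (3 * (a i)\<^sup>2 / (8 * \<sigma>\<^sup>2))) \<le> 8 * real n"
    and near: "l2norm n (\<lambda>i. e i - a i) \<le> R" and "0 \<le> R"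
    and R: "R\<^sup>2 \<le> 48 * (\<Sum>j = 1..k. (slope_weights \<sigma> p j)\<^sup>2)" "R\<^sup>2 \<le> 48 * (\<Sum>j = 1..s. (slope_weights \<sigma> n j)\<^sup>2)"
    and min: "is_mshift_min n p X (\<lambda>i. matvec p X bs i + ms i + e i) \<rho> (slope_weights \<sigma> p) (slope_weights \<sigma> n) bh mh"
  shows "(l2norm p (\<lambda>j. bh j - bs j))\<^sup>2 + (l2norm n (\<lambda>i. mh i - ms i))\<^sup>2
    \<le> (64 * \<rho>\<^sup>2 + 384) / (sqrt (\<kappa>1 - 2 * \<kappa>2)) ^ 4
      * ((\<Sum>j = 1..k. (slope_weights \<sigma> p j)\<^sup>2) + (\<Sum>j = 1..s. (slope_weights \<sigma> n j)\<^sup>2))"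
proof -
  let ?db = "\<lambda>j. bh j - bs j" and ?dm = "\<lambda>i. mh i - ms i"
  let ?lp = "slope_weights \<sigma> p" and ?ln = "slope_weights \<sigma> n"
  define v where "v i = matvec p X ?db i + ?dm i" for i
  define V where "V = l2norm n v"
  define J where "J = sorted_l1 p ?lp ?db + sorted_l1 n ?ln ?dm"
  define x where "x = sqrt (\<Sum>j = 1..k. (?lp j)\<^sup>2)"
  define z where "z = sqrt (\<Sum>j = 1..s. (?ln j)\<^sup>2)"
  define b where "b = l2norm p ?db"
  define m where "m = l2norm n ?dm"
  define \<kappa> where "\<kappa> = sqrt (\<kappa>1 - 2 * \<kappa>2)"
  have bm: "0 \<le> b" "0 \<le> m" by (simp_all add: b_def m_def)
  have x2: "x\<^sup>2 = (\<Sum>j = 1..k. (?lp j)\<^sup>2)" and z2: "z\<^sup>2 = (\<Sum>j = 1..s. (?ln j)\<^sup>2)"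
    by (simp_all add: x_def z_def sum_nonneg)
  have pos: "0 < x" "0 < z"
    using dims \<sigma> by (auto simp: x_def z_def intro!: sum_pos zero_less_power slope_weights_pos)
  \<comment> \<open>\<open>\<kappa> \<le> 1\<close> lets the bounds inside and outside the cone be
    merged under the single factor \<open>1 / \<kappa> ^ 4\<close>.\<close>
  have "0 < \<kappa>" "\<kappa> \<le> 1" using \<kappa> restricted_eigenvalue_le_1 by (simp_all add: \<kappa>_def)
  have \<kappa>2: "\<kappa>\<^sup>2 = \<kappa>1 - 2 * \<kappa>2" using \<kappa> by (simp add: \<kappa>_def)
  have "0 \<le> J" unfolding J_def
    by (intro add_nonneg_nonneg sorted_l1_nonneg slope_weights_nonneg \<sigma>)
  have "V\<^sup>2 \<le> 2 * inner_n n e v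
      + 2 * \<rho> * (sorted_l1 p ?lp bs - sorted_l1 p ?lp bh) + 2 * \<rho> * (sorted_l1 n ?ln ms - sorted_l1 n ?ln mh)"
    using mshift_basic_inequality[OF min] by (simp add: V_def v_def[abs_def])
  moreover have "inner_n n e v \<le> 3 * J + R * V"
    using noise_inner_le[OF \<sigma> aX aI near, of ?db ?dm] by (simp add: V_def J_def v_def[abs_def])
  moreover have "2 * \<rho> * (sorted_l1 p ?lp bs - sorted_l1 p ?lp bh) \<le> 2 * \<rho> * (2 * (x * b) - sorted_l1 p ?lp ?db)"
    unfolding x_def b_def using \<rho> dims \<sigma> sparse
    by (intro mult_left_mono sorted_l1_sparse_diff slope_weights_antimono slope_weights_nonneg) auto
  moreover have "2 * \<rho> * (sorted_l1 n ?ln ms - sorted_l1 n ?ln mh) \<le> 2 * \<rho> * (2 * (z * m) - sorted_l1 n ?ln ?dm)"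
    unfolding z_def m_def using \<rho> dims \<sigma> sparse
    by (intro mult_left_mono sorted_l1_sparse_diff slope_weights_antimono slope_weights_nonneg) auto
  ultimately have main: "V\<^sup>2 \<le> 6 * J + 2 * (R * V) + 2 * \<rho> * (2 * (x * b + z * m) - J)"
    by (simp add: J_def algebra_simps)
  let ?K = "\<sigma> * sqrt (real k * ln (2 * exp 1 * real p / real k))"
  let ?S = "\<sigma> * sqrt (real s * ln (2 * exp 1 * real n / real s))"
  \<comment> \<open>The cone is defined by \<open>?K\<close> and \<open>?S\<close>, which dominate
    \<open>x\<close> and \<open>z\<close>; an error outside it therefore satisfies
    \<open>5 * (x * b + z * m) \<le> J\<close>, as the second scalar bound requires.\<close>
  have "x \<le> ?K" "z \<le> ?S"
    using real_sqrt_le_mono[OF sum_slope_weights_le[of k p \<sigma>]]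
      real_sqrt_le_mono[OF sum_slope_weights_le[of s n \<sigma>]] dims \<sigma>
    by (simp_all add: x_def z_def real_sqrt_mult)
  then have W: "x * b + z * m \<le> ?K * b + ?S * m"
    using bm by (intro add_mono mult_right_mono)
  have "b\<^sup>2 + m\<^sup>2 \<le> (64 * \<rho>\<^sup>2 + 384) / \<kappa> ^ 4 * (x\<^sup>2 + z\<^sup>2)"
  proof (cases "J \<le> 5 * (?K * b + ?S * m)")
    case True
    then have re: "\<kappa>1 * (b\<^sup>2 + m\<^sup>2) \<le> (l2norm n (matvec p X ?db))\<^sup>2 + m\<^sup>2"
      "\<bar>inner_n n (matvec p X ?db) ?dm\<bar> \<le> \<kappa>2 * (b\<^sup>2 + m\<^sup>2)"
      using RE[of ?db ?dm] by (auto simp: J_def b_def m_def)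
    have "V\<^sup>2 = (l2norm n (matvec p X ?db))\<^sup>2 + 2 * inner_n n (matvec p X ?db) ?dm + m\<^sup>2"
      unfolding V_def v_def[abs_def] m_def by (rule l2norm_add_power2)
    \<comment> \<open>The cross term costs at most \<open>2 * \<kappa>2\<close>, which leaves the
      effective constant \<open>\<kappa>1 - 2 * \<kappa>2\<close>.\<close>
    then have "\<kappa>\<^sup>2 * (b\<^sup>2 + m\<^sup>2) \<le> V\<^sup>2"
      using re unfolding \<kappa>2 by (simp add: left_diff_distrib abs_le_iff)
    moreover have "R\<^sup>2 \<le> 48 * (x\<^sup>2 + z\<^sup>2)" using R(1) x2 by (simp add: distrib_left add_increasing2)
    ultimately show ?thesis
      using bm \<open>0 \<le> J\<close> \<rho> \<open>0 < \<kappa>\<close> \<open>\<kappa> \<le> 1\<close> pos main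
      by (intro error_bound_in_cone[where V = V and J = J and R = R]) auto
  next
    case False
    have "b\<^sup>2 + m\<^sup>2 \<le> 48 * (x\<^sup>2 + z\<^sup>2)"
      using bm \<rho> pos main R x2 z2 False W \<open>0 \<le> R\<close>
      by (intro error_bound_outside_cone[where V = V and J = J and R = R]) auto
    also have "\<dots> \<le> (64 * \<rho>\<^sup>2 + 384) / \<kappa> ^ 4 * (x\<^sup>2 + z\<^sup>2)"
    proof (rule mult_right_mono)
      have "\<kappa> ^ 4 \<le> 1" using \<open>0 < \<kappa>\<close> \<open>\<kappa> \<le> 1\<close> by (simp add: power_le_one)
      then have "48 * \<kappa> ^ 4 \<le> 64 * \<rho>\<^sup>2 + 384" using zero_le_power2[of \<rho>] by linarith
      then show "48 \<le> (64 * \<rho>\<^sup>2 + 384) / \<kappa> ^ 4" using \<open>0 < \<kappa>\<close> by (simp add: pos_le_divide_eq)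
    qed simp
    finally show ?thesis .
  qed
  then show ?thesis by (simp add: b_def m_def \<kappa>_def x2 z2)
qed

text \<open>The event is fixed before any minimizer is chosen, so the bound holds for all minimizers
  at once and raises no question of their measurability.\<close>

lemma mshift_event:
  assumes \<rho>: "10 \<le> \<rho>" and sparse: "l0 p bs \<le> k" "l0 n ms \<le> s"
  obtains E where "E \<in> sets (gauss_noise n \<sigma>)"
    "measure (gauss_noise n \<sigma>) E \<ge> 1 - (1/2) * (real s / (2 * real n)) ^ s - (1/2) * (real k / (2 * real p)) ^ k"
    "\<And>e bh mh. e \<in> E \<Longrightarrow>
      is_mshift_min n p X (\<lambda>i. matvec p X bs i + ms i + e i) \<rho> (slope_weights \<sigma> p) (slope_weights \<sigma> n) bh mh \<Longrightarrow>
      (l2norm p (\<lambda>j. bh j - bs j))\<^sup>2 + (l2norm n (\<lambda>i. mh i - ms i))\<^sup>2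
      \<le> (64 * \<rho>\<^sup>2 + 384) / (sqrt (\<kappa>1 - 2 * \<kappa>2)) ^ 4
        * ((\<Sum>j = 1..k. (slope_weights \<sigma> p j)\<^sup>2) + (\<Sum>j = 1..s. (slope_weights \<sigma> n j)\<^sup>2))"
proof -
  let ?G = "gauss_noise n \<sigma>"
  interpret prob_space ?G by (rule prob_space_gauss_noise) (rule \<sigma>)
  define BX where "BX = {x \<in> space ?G. (\<Sum>j<p. exp (3 * (\<Sum>i<n. X i j * x i)\<^sup>2 / (8 * \<sigma>\<^sup>2))) > 8 * real p}"
  define BI where "BI = {x \<in> space ?G. (\<Sum>j<n. exp (3 * (x j)\<^sup>2 / (8 * \<sigma>\<^sup>2))) > 8 * real n}"
  have BX: "BX \<in> events" "prob BX \<le> 1 / 4"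
    using prob_sum_exp_square_le[where \<sigma> = \<sigma> and m = p and n = n and c = "\<lambda>j i. X i j"] dims \<sigma> cols by (simp_all add: BX_def)
  \<comment> \<open>The coordinates of the noise are its correlations with the columns of the
    identity, so the same moment bound covers \<open>BI\<close>.\<close>
  have unit: "(\<Sum>i<n. (if i = j then 1 else 0) * x i) = x j" if "j < n" for x :: "nat \<Rightarrow> real" and j
    using that by (simp add: if_distrib[of "\<lambda>c. c * _"] sum.delta' cong: if_cong)
  have "(\<Sum>i<n. (if i = j then 1 else 0)\<^sup>2) = (1 :: real)" if "j < n" for j
    using that by (simp add: if_distrib[of "\<lambda>c. c\<^sup>2"] sum.delta' cong: if_cong)
  then have BI: "BI \<in> events" "prob BI \<le> 1 / 4"
    using prob_sum_exp_square_le[where \<sigma> = \<sigma> and m = n and n = n and c = "\<lambda>j i. if i = j then 1 else 0"] dims \<sigma>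
    by (simp_all add: BI_def unit cong: sum.cong_simp)
  define A where "A = space ?G - (BX \<union> BI)"
  \<comment> \<open>The two exceptional sets cost 1/4 each, which leaves the mass 1/2 required for
    concentration.\<close>
  have "prob (BX \<union> BI) \<le> 1 / 2"
    using measure_Un_le[of BX ?G BI] BX BI by simp
  then have A: "A \<in> events" "prob A \<ge> 1 / 2"
    using BX BI prob_compl[of "BX \<union> BI"] by (auto simp: A_def)
  define tk where "tk = real k * ln (2 * real p / real k)"
  define ts where "ts = real s * ln (2 * real n / real s)"
  \<comment> \<open>The minimum keeps the squared radius below 48 times each weight sum separately.
    Then \<open>exp (- t)\<close> is the larger of the two target probabilities, hence below their
    sum.\<close>
  define t where "t = min tk ts"
  have ln2: "ln 2 \<le> real j * ln (2 * real m / real j)" if "1 \<le> j" "j \<le> m" for j m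
  proof -
    have "ln 2 \<le> ln (2 * real m / real j)" using that by (intro ln_mono) (auto simp: field_simps)
    also have "\<dots> \<le> real j * ln (2 * real m / real j)"
      using that slope_weights_log_pos[of j m] by simp
    finally show ?thesis .
  qed
  have t: "ln 2 \<le> t" using ln2 dims by (simp add: t_def tk_def ts_def)
  have "0 < ln (2 :: real)" by simp
  with t have "0 < t" by linarith
  have pw: "exp (- (real j * ln (2 * real m / real j))) = (real j / (2 * real m)) ^ j" if "1 \<le> j" "j \<le> m" for j m
  proof -
    have "exp (- (real j * ln (2 * real m / real j))) = exp (ln (real j / (2 * real m))) ^ j"
      using that by (simp add: exp_of_nat_mult[symmetric] ln_div)
         (simp add: algebra_simps)
    then show ?thesis using that by simp
  qed
  \<comment> \<open>The 12 makes the concentration exponent \<open>3 * t\<close>: two factors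
    \<open>exp (- t) \<le> 1/2\<close> reduce the leading 2 to 1/2. The distance
    \<open>2 * r\<close> has square \<open>48 * \<sigma>^2 * t\<close>, the source of the constant
    48.\<close>
  define r where "r = \<sigma> * sqrt (12 * t)"
  have "0 < r" using \<sigma> \<open>0 < t\<close> by (simp add: r_def)
  have r2: "r\<^sup>2 = 12 * \<sigma>\<^sup>2 * t" using \<open>0 < t\<close> by (simp add: r_def power_mult_distrib)
  obtain E where E: "E \<in> events" "prob E \<ge> 1 - 2 * exp (- r\<^sup>2 / (4 * \<sigma>\<^sup>2))"
    "\<And>x. x \<in> E \<Longrightarrow> \<exists>a\<in>A. l2norm n (\<lambda>i. x i - a i) \<le> 2 * r"
    using gauss_concentration[OF \<sigma> \<open>0 < r\<close> A] by blast
  have "2 * exp (- r\<^sup>2 / (4 * \<sigma>\<^sup>2)) \<le> (1/2) * (real s / (2 * real n)) ^ s + (1/2) * (real k / (2 * real p)) ^ k"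
  proof -
    have "- r\<^sup>2 / (4 * \<sigma>\<^sup>2) = - t + (- t) + (- t)" using \<sigma> by (simp add: r2)
    then have "exp (- r\<^sup>2 / (4 * \<sigma>\<^sup>2)) = exp (- t) * exp (- t) * exp (- t)" by (simp only: exp_add)
    also have "\<dots> \<le> 1 / 2 * (1 / 2) * exp (- t)"
    proof -
      have "exp (- t) \<le> exp (- ln 2)" using t by simp
      also have "\<dots> = 1 / 2" by (simp add: exp_minus)
      finally show ?thesis by (intro mult_right_mono mult_mono) auto
    qed
    finally have "2 * exp (- r\<^sup>2 / (4 * \<sigma>\<^sup>2)) \<le> exp (- t) / 2" by simp
    also have "\<dots> \<le> exp (- ts) / 2 + exp (- tk) / 2" by (auto simp: t_def min_def)
    also have "\<dots> = (1/2) * (real s / (2 * real n)) ^ s + (1/2) * (real k / (2 * real p)) ^ k"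
      using pw dims by (simp add: ts_def tk_def)
    finally show ?thesis .
  qed
  then have prob_E: "prob E \<ge> 1 - (1/2) * (real s / (2 * real n)) ^ s - (1/2) * (real k / (2 * real p)) ^ k"
    using E(2) by linarith
  have R2: "(2 * r)\<^sup>2 \<le> 48 * (\<sigma>\<^sup>2 * tk)" "(2 * r)\<^sup>2 \<le> 48 * (\<sigma>\<^sup>2 * ts)"
    by (simp_all add: power_mult_distrib r2 t_def mult_left_mono)
  have R: "(2 * r)\<^sup>2 \<le> 48 * (\<Sum>j = 1..k. (slope_weights \<sigma> p j)\<^sup>2)" "(2 * r)\<^sup>2 \<le> 48 * (\<Sum>j = 1..s. (slope_weights \<sigma> n j)\<^sup>2)"
    using sum_slope_weights_ge[OF \<sigma> dims(1,2)] sum_slope_weights_ge[OF \<sigma> dims(3,4)]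
    unfolding tk_def[symmetric] ts_def[symmetric]
    by - (rule order_trans[OF R2(1)] order_trans[OF R2(2)], simp)+
  show ?thesis
  proof (rule that[OF E(1) prob_E])
    fix e bh mh
    assume "e \<in> E" and min: "is_mshift_min n p X (\<lambda>i. matvec p X bs i + ms i + e i) \<rho>
      (slope_weights \<sigma> p) (slope_weights \<sigma> n) bh mh"
    then obtain a where a: "a \<in> A" "l2norm n (\<lambda>i. e i - a i) \<le> 2 * r" using E(3) by blast
    show "(l2norm p (\<lambda>j. bh j - bs j))\<^sup>2 + (l2norm n (\<lambda>i. mh i - ms i))\<^sup>2
      \<le> (64 * \<rho>\<^sup>2 + 384) / (sqrt (\<kappa>1 - 2 * \<kappa>2)) ^ 4
        * ((\<Sum>j = 1..k. (slope_weights \<sigma> p j)\<^sup>2) + (\<Sum>j = 1..s. (slope_weights \<sigma> n j)\<^sup>2))"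
      by (rule mshift_error_bound[OF \<rho> sparse _ _ a(2) _ R min])
        (use a(1) \<open>0 < r\<close> in \<open>auto simp: A_def BX_def BI_def not_less\<close>)
  qed
qed

end

theorem theorem4:
  fixes \<rho> :: real
  assumes "\<rho> \<ge> 2 * (4 + sqrt 2)"
  shows "\<exists>C'>0. \<forall>(n::nat) (p::nat) (X::nat \<Rightarrow> nat \<Rightarrow> real) (\<beta>s::nat \<Rightarrow> real) (\<mu>s::nat \<Rightarrow> real)
            (k::nat) (s::nat) (\<sigma>::real) (\<kappa>1::real) (\<kappa>2::real).
     (let lam = slope_weights \<sigma> n; lamt = slope_weights \<sigma> p;
          k1 = real k * ln (2 * exp 1 * real p / real k) / ln 2;
          s1 = real s * ln (2 * exp 1 * real n / real s) / ln 2;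
          \<kappa> = sqrt (\<kappa>1 - 2 * \<kappa>2)
      in
       1 \<le> k \<and> k \<le> p \<and> 1 \<le> s \<and> s \<le> n \<and> 0 < \<sigma> \<and>
       (\<forall>j<p. (\<Sum>i<n. (X i j)\<^sup>2) = 1) \<and>
       l0 p \<beta>s \<le> k \<and> l0 n \<mu>s \<le> s \<and>
       \<kappa>1 > 2 * \<kappa>2 \<and> 2 * \<kappa>2 > 0 \<and>
       (\<forall>\<beta> \<mu>.
          (\<Sum>j=1..p. lamt j / lamt p * sorted_abs p \<beta> j) + (\<Sum>j=1..n. lam j / lam n * sorted_abs n \<mu> j)
            \<le> 5 * (sqrt k1 * l2norm p \<beta> + sqrt s1 * l2norm n \<mu>)
          \<longrightarrow> (l2norm n (matvec p X \<beta>))\<^sup>2 + (l2norm n \<mu>)\<^sup>2 \<ge> \<kappa>1 * ((l2norm p \<beta>)\<^sup>2 + (l2norm n \<mu>)\<^sup>2)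
            \<and> \<bar>inner_n n (matvec p X \<beta>) \<mu>\<bar> \<le> \<kappa>2 * ((l2norm p \<beta>)\<^sup>2 + (l2norm n \<mu>)\<^sup>2))
      \<longrightarrow>
       (\<exists>E \<in> sets (gauss_noise n \<sigma>).
          measure (gauss_noise n \<sigma>) E
            \<ge> 1 - (1/2) * (real s / (2 * real n)) ^ s - (1/2) * (real k / (2 * real p)) ^ k \<and>
          (\<forall>\<epsilon>\<in>E. \<forall>\<beta>h \<mu>h.
             is_mshift_min n p X (\<lambda>i. matvec p X \<beta>s i + \<mu>s i + \<epsilon> i) \<rho> lamt lam \<beta>h \<mu>h \<longrightarrow>
               (l2norm p (\<lambda>j. \<beta>h j - \<beta>s j))\<^sup>2 + (l2norm n (\<lambda>i. \<mu>h i - \<mu>s i))\<^sup>2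
                 \<le> C' / \<kappa> ^ 4 * ((\<Sum>j=1..k. (lamt j)\<^sup>2) + (\<Sum>j=1..s. (lam j)\<^sup>2))
               \<and> C' / \<kappa> ^ 4 * ((\<Sum>j=1..k. (lamt j)\<^sup>2) + (\<Sum>j=1..s. (lam j)\<^sup>2))
                 \<le> C' * \<sigma>\<^sup>2 / \<kappa> ^ 4 * (real k * ln (2 * exp 1 * real p / real k)
                                          + real s * ln (2 * exp 1 * real n / real s)))))"
\<comment> \<open>The witness is the constant from the quadratic inequality inside the cone; it
  depends on \<open>\<rho>\<close> alone.\<close>
proof (intro exI[of _ "64 * \<rho>\<^sup>2 + 384"] conjI allI)
  show "0 < 64 * \<rho>\<^sup>2 + 384" by (simp add: add_nonneg_pos)
next
  fix n p :: nat and X :: "nat \<Rightarrow> nat \<Rightarrow> real" and bs ms :: "nat \<Rightarrow> real" and k s :: nat and \<sigma> \<kappa>1 \<kappa>2 :: real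
  \<comment> \<open>Since \<open>sqrt 2 \<ge> 1\<close>, the threshold is at least 10, the value the
    scalar bounds work with.\<close>
  have \<rho>: "10 \<le> \<rho>"
  proof (rule order_trans[OF _ assms])
    have "2 * (4 + 1) \<le> 2 * (4 + sqrt (2 :: real))" by (intro mult_left_mono add_left_mono) auto
    then show "10 \<le> 2 * (4 + sqrt (2 :: real))" by simp
  qed
  let ?L = "(\<Sum>j = 1..k. (slope_weights \<sigma> p j)\<^sup>2) + (\<Sum>j = 1..s. (slope_weights \<sigma> n j)\<^sup>2)"
  let ?C = "64 * \<rho>\<^sup>2 + 384"
  show "(let lam = slope_weights \<sigma> n; lamt = slope_weights \<sigma> p;
          k1 = real k * ln (2 * exp 1 * real p / real k) / ln 2;
          s1 = real s * ln (2 * exp 1 * real n / real s) / ln 2;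
          \<kappa> = sqrt (\<kappa>1 - 2 * \<kappa>2)
      in
       1 \<le> k \<and> k \<le> p \<and> 1 \<le> s \<and> s \<le> n \<and> 0 < \<sigma> \<and>
       (\<forall>j<p. (\<Sum>i<n. (X i j)\<^sup>2) = 1) \<and>
       l0 p bs \<le> k \<and> l0 n ms \<le> s \<and>
       \<kappa>1 > 2 * \<kappa>2 \<and> 2 * \<kappa>2 > 0 \<and>
       (\<forall>\<beta> \<mu>.
          (\<Sum>j=1..p. lamt j / lamt p * sorted_abs p \<beta> j) + (\<Sum>j=1..n. lam j / lam n * sorted_abs n \<mu> j)
            \<le> 5 * (sqrt k1 * l2norm p \<beta> + sqrt s1 * l2norm n \<mu>)
          \<longrightarrow> (l2norm n (matvec p X \<beta>))\<^sup>2 + (l2norm n \<mu>)\<^sup>2 \<ge> \<kappa>1 * ((l2norm p \<beta>)\<^sup>2 + (l2norm n \<mu>)\<^sup>2)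
            \<and> \<bar>inner_n n (matvec p X \<beta>) \<mu>\<bar> \<le> \<kappa>2 * ((l2norm p \<beta>)\<^sup>2 + (l2norm n \<mu>)\<^sup>2))
      \<longrightarrow>
       (\<exists>E \<in> sets (gauss_noise n \<sigma>).
          measure (gauss_noise n \<sigma>) E
            \<ge> 1 - (1/2) * (real s / (2 * real n)) ^ s - (1/2) * (real k / (2 * real p)) ^ k \<and>
          (\<forall>\<epsilon>\<in>E. \<forall>\<beta>h \<mu>h.
             is_mshift_min n p X (\<lambda>i. matvec p X bs i + ms i + \<epsilon> i) \<rho> lamt lam \<beta>h \<mu>h \<longrightarrow>
               (l2norm p (\<lambda>j. \<beta>h j - bs j))\<^sup>2 + (l2norm n (\<lambda>i. \<mu>h i - ms i))\<^sup>2
                 \<le> (64 * \<rho>\<^sup>2 + 384) / \<kappa> ^ 4 * ((\<Sum>j=1..k. (lamt j)\<^sup>2) + (\<Sum>j=1..s. (lam j)\<^sup>2))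
               \<and> (64 * \<rho>\<^sup>2 + 384) / \<kappa> ^ 4 * ((\<Sum>j=1..k. (lamt j)\<^sup>2) + (\<Sum>j=1..s. (lam j)\<^sup>2))
                 \<le> (64 * \<rho>\<^sup>2 + 384) * \<sigma>\<^sup>2 / \<kappa> ^ 4 * (real k * ln (2 * exp 1 * real p / real k)
                                          + real s * ln (2 * exp 1 * real n / real s)))))"
    unfolding Let_def
  proof (intro impI, elim conjE)
    assume dims: "1 \<le> k" "k \<le> p" "1 \<le> s" "s \<le> n" and \<sigma>: "0 < \<sigma>"
      and cols: "\<forall>j<p. (\<Sum>i<n. (X i j)\<^sup>2) = 1"
      and sparse: "l0 p bs \<le> k" "l0 n ms \<le> s"
      and \<kappa>: "2 * \<kappa>2 < \<kappa>1" "0 < 2 * \<kappa>2"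
      and RE: "\<forall>\<beta> \<mu>. (\<Sum>j = 1..p. slope_weights \<sigma> p j / slope_weights \<sigma> p p * sorted_abs p \<beta> j)
          + (\<Sum>j = 1..n. slope_weights \<sigma> n j / slope_weights \<sigma> n n * sorted_abs n \<mu> j)
          \<le> 5 * (sqrt (real k * ln (2 * exp 1 * real p / real k) / ln 2) * l2norm p \<beta>
            + sqrt (real s * ln (2 * exp 1 * real n / real s) / ln 2) * l2norm n \<mu>)
        \<longrightarrow> \<kappa>1 * ((l2norm p \<beta>)\<^sup>2 + (l2norm n \<mu>)\<^sup>2) \<le> (l2norm n (matvec p X \<beta>))\<^sup>2 + (l2norm n \<mu>)\<^sup>2
          \<and> \<bar>inner_n n (matvec p X \<beta>) \<mu>\<bar> \<le> \<kappa>2 * ((l2norm p \<beta>)\<^sup>2 + (l2norm n \<mu>)\<^sup>2)"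
    have pn: "1 \<le> p" "1 \<le> n" using dims by auto
    have RE': "\<kappa>1 * ((l2norm p b)\<^sup>2 + (l2norm n m)\<^sup>2) \<le> (l2norm n (matvec p X b))\<^sup>2 + (l2norm n m)\<^sup>2
        \<and> \<bar>inner_n n (matvec p X b) m\<bar> \<le> \<kappa>2 * ((l2norm p b)\<^sup>2 + (l2norm n m)\<^sup>2)"
      if "sorted_l1 p (slope_weights \<sigma> p) b + sorted_l1 n (slope_weights \<sigma> n) m
        \<le> 5 * (\<sigma> * sqrt (real k * ln (2 * exp 1 * real p / real k)) * l2norm p b
          + \<sigma> * sqrt (real s * ln (2 * exp 1 * real n / real s)) * l2norm n m)" for b m
      using that RE unfolding cone_condition_iff[OF \<sigma> pn dims] by blast
    obtain E where E: "E \<in> sets (gauss_noise n \<sigma>)"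
      "measure (gauss_noise n \<sigma>) E \<ge> 1 - (1/2) * (real s / (2 * real n)) ^ s - (1/2) * (real k / (2 * real p)) ^ k"
      "\<And>e bh mh. e \<in> E \<Longrightarrow>
        is_mshift_min n p X (\<lambda>i. matvec p X bs i + ms i + e i) \<rho> (slope_weights \<sigma> p) (slope_weights \<sigma> n) bh mh \<Longrightarrow>
        (l2norm p (\<lambda>j. bh j - bs j))\<^sup>2 + (l2norm n (\<lambda>i. mh i - ms i))\<^sup>2
        \<le> ?C / (sqrt (\<kappa>1 - 2 * \<kappa>2)) ^ 4 * ?L"
      using mshift_event[OF dims \<sigma> _ \<kappa> RE' \<rho> sparse] cols by blast
    have "?L \<le> \<sigma>\<^sup>2 * (real k * ln (2 * exp 1 * real p / real k) + real s * ln (2 * exp 1 * real n / real s))"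
      using sum_slope_weights_le[of k p \<sigma>] sum_slope_weights_le[of s n \<sigma>] dims by (simp add: distrib_left)
    then have "?C / (sqrt (\<kappa>1 - 2 * \<kappa>2)) ^ 4 * ?L \<le> ?C / (sqrt (\<kappa>1 - 2 * \<kappa>2)) ^ 4
        * (\<sigma>\<^sup>2 * (real k * ln (2 * exp 1 * real p / real k) + real s * ln (2 * exp 1 * real n / real s)))"
      using \<kappa> by (intro mult_left_mono) auto
    then have "?C / (sqrt (\<kappa>1 - 2 * \<kappa>2)) ^ 4 * ?L \<le> ?C * \<sigma>\<^sup>2 / (sqrt (\<kappa>1 - 2 * \<kappa>2)) ^ 4
        * (real k * ln (2 * exp 1 * real p / real k) + real s * ln (2 * exp 1 * real n / real s))"
      by simp
    then show "\<exists>E\<in>sets (gauss_noise n \<sigma>).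
        1 - 1 / 2 * (real s / (2 * real n)) ^ s - 1 / 2 * (real k / (2 * real p)) ^ k
          \<le> measure (gauss_noise n \<sigma>) E \<and>
        (\<forall>\<epsilon>\<in>E. \<forall>\<beta>h \<mu>h.
          is_mshift_min n p X (\<lambda>i. matvec p X bs i + ms i + \<epsilon> i) \<rho> (slope_weights \<sigma> p) (slope_weights \<sigma> n) \<beta>h \<mu>h \<longrightarrow>
            (l2norm p (\<lambda>j. \<beta>h j - bs j))\<^sup>2 + (l2norm n (\<lambda>i. \<mu>h i - ms i))\<^sup>2
              \<le> ?C / (sqrt (\<kappa>1 - 2 * \<kappa>2)) ^ 4 * ?L
            \<and> ?C / (sqrt (\<kappa>1 - 2 * \<kappa>2)) ^ 4 * ?L
              \<le> ?C * \<sigma>\<^sup>2 / (sqrt (\<kappa>1 - 2 * \<kappa>2)) ^ 4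
                * (real k * ln (2 * exp 1 * real p / real k) + real s * ln (2 * exp 1 * real n / real s)))"
      using E by blast
  qed
qed

end
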